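(* Let $L$ be a complete enriched Lie algebra such that $L/L^2$ is a graded vector space of finite type (i.e. finite dimensional in each degree). Then $L$ has a unique (up to equivalence) structure $(L,\mathcal I)$ as an enriched Lie algebra, namely the one given by $$\mathcal I=\{I_k\}_{k\ge 1},\qquad I_k=L^k+L_{\ge k}.$$
   Context: All vector spaces are graded, over $\mathbb Q$. An enriched Lie algebra is a graded Lie algebra $L=L_{\ge 0}$ together with a family $\mathcal I=\{I_\alpha\}$ of (graded) ideals such that: (i) each $L_\alpha:=L/I_\alpha$ is a finite dimensional nilpotent Lie algebra; (ii) for all $\alpha,\beta$ there is $\gamma$ with $I_\gamma\subset I_\alpha\cap I_\beta$ (so the index set is directed by $\alpha\ge\beta\iff I_\alpha\subset I_\beta$); (iii) $\bigcap_\alpha I_\alpha=0$. It is complete if the natural map $L\to\varprojlim_\alpha L/I_\alpha$ is an isomorphism (limits of graded spaces are taken degreewise). $L^k$ denotes the linear span of the iterated Lie brackets of length $k$ of elements of $L$ ($L^1=L$, $L^2=[L,L]$), and $L_{\ge k}=\oplus_{i\ge k}L_i$. A morphism $(E,\mathcal J)\to(F,\mathcal I)$ of enriched Lie algebras is a degree $0$ homomorphism $\varphi$ of graded Lie algebras such that for each $I_\alpha\in\mathcal I$ there is $J_\beta\in\mathcal J$ with $J_\beta\subset\varphi^{-1}(I_\alpha)$. Two families $\mathcal I,\mathcal I'$ of ideals making $L$ an enriched Lie algebra are equivalent if the identity of $L$ is a morphism $(L,\mathcal I)\to(L,\mathcal I')$ and a morphism $(L,\mathcal I')\to(L,\mathcal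 I)$. *)

theory Defs
  imports Complex_Main "HOL-Algebra.AbelCoset" "Jordan_Normal_Form.Missing_VectorSpace"
begin

definition rat_field :: "rat ring" where
  "rat_field = \<lparr>carrier = UNIV, mult = (*), one = 1, zero = 0, add = (+)\<rparr>"

text \<open>
  A graded Lie algebra is carried by its total space, the direct sum of its homogeneous parts.
  The grading is by natural numbers, as all degrees are nonnegative.
  The fields \<open>mult\<close> and \<open>one\<close>, inherited from the record type for modules, play no role.
\<close>

record 'a graded_lie = "(rat, 'a) module" +
  bracket :: "'a \<Rightarrow> 'a \<Rightarrow> 'a"
  part :: "nat \<Rightarrow> 'a set"

text \<open>
  Over the rationals, graded antisymmetry and the graded Jacobi identity imply \<open>[x, x] = 0\<close> for
  \<open>x\<close> of even degree and \<open>[x, [x, x]] = 0\<close> for \<open>x\<close> of odd degree.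
\<close>

locale graded_lie_algebra = vectorspace rat_field L for L :: "'a graded_lie" +
  assumes part_subspace: "subspace rat_field (part L n) L"
    and part_decomposition: "x \<in> carrier L \<Longrightarrow>
      \<exists>!f. (\<forall>n. f n \<in> part L n) \<and> finite {n. f n \<noteq> \<zero>\<^bsub>L\<^esub>} \<and>
        x = (\<Oplus>\<^bsub>L\<^esub>n\<in>{n. f n \<noteq> \<zero>\<^bsub>L\<^esub>}. f n)"
    and bracket_closed: "x \<in> carrier L \<Longrightarrow> y \<in> carrier L \<Longrightarrow> bracket L x y \<in> carrier L"
    and bracket_add_left: "x \<in> carrier L \<Longrightarrow> y \<in> carrier L \<Longrightarrow> z \<in> carrier L \<Longrightarrow>
      bracket L (x \<oplus>\<^bsub>L\<^esub> y) z = bracket L x z \<oplus>\<^bsub>L\<^esub> bracket L y z"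
    and bracket_add_right: "x \<in> carrier L \<Longrightarrow> y \<in> carrier L \<Longrightarrow> z \<in> carrier L \<Longrightarrow>
      bracket L x (y \<oplus>\<^bsub>L\<^esub> z) = bracket L x y \<oplus>\<^bsub>L\<^esub> bracket L x z"
    and bracket_smult_left: "x \<in> carrier L \<Longrightarrow> y \<in> carrier L \<Longrightarrow>
      bracket L (c \<odot>\<^bsub>L\<^esub> x) y = c \<odot>\<^bsub>L\<^esub> bracket L x y"
    and bracket_smult_right: "x \<in> carrier L \<Longrightarrow> y \<in> carrier L \<Longrightarrow>
      bracket L x (c \<odot>\<^bsub>L\<^esub> y) = c \<odot>\<^bsub>L\<^esub> bracket L x y"
    and bracket_part: "x \<in> part L i \<Longrightarrow> y \<in> part L j \<Longrightarrow> bracket L x y \<in> part L (i + j)"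
    and bracket_antisym: "x \<in> part L i \<Longrightarrow> y \<in> part L j \<Longrightarrow>
      bracket L x y = \<ominus>\<^bsub>L\<^esub> ((- 1) ^ (i * j) \<odot>\<^bsub>L\<^esub> bracket L y x)"
    and bracket_jacobi: "x \<in> part L i \<Longrightarrow> y \<in> part L j \<Longrightarrow> z \<in> part L k \<Longrightarrow>
      bracket L x (bracket L y z) =
        bracket L (bracket L x y) z \<oplus>\<^bsub>L\<^esub> (- 1) ^ (i * j) \<odot>\<^bsub>L\<^esub> bracket L y (bracket L x z)"

definition lin_span :: "'a graded_lie \<Rightarrow> 'a set \<Rightarrow> 'a set" where
  "lin_span L S = module.span rat_field L S"

definition graded_ideal :: "'a graded_lie \<Rightarrow> 'a set \<Rightarrow> bool" where
  "graded_ideal L I \<longleftrightarrow>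
     subspace rat_field I L \<and>
     I = lin_span L (\<Union>n. I \<inter> part L n) \<and>
     (\<forall>x\<in>carrier L. \<forall>y\<in>I. bracket L x y \<in> I \<and> bracket L y x \<in> I)"

text \<open>
  The quotient by a graded ideal has the cosets \<open>I +> x\<close> as elements; the operations are induced
  through representatives, as in \<open>FactRing\<close>.
\<close>

definition quotient_lie :: "'a graded_lie \<Rightarrow> 'a set \<Rightarrow> 'a set graded_lie" where
  "quotient_lie L I =
    \<lparr>carrier = a_rcosets\<^bsub>L\<^esub> I,
     mult = (\<lambda>X Y. I),
     one = I,
     zero = I,
     add = (\<lambda>X Y. X <+>\<^bsub>L\<^esub> Y),
     smult = (\<lambda>c X. \<Union>x\<in>X. I +>\<^bsub>L\<^esub> (c \<odot>\<^bsub>L\<^esub> x)),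
     bracket = (\<lambda>X Y. \<Union>x\<in>X. \<Union>y\<in>Y. I +>\<^bsub>L\<^esub> bracket L x y),
     part = (\<lambda>n. (\<lambda>x. I +>\<^bsub>L\<^esub> x) ` part L n)\<rparr>"

definition fin_dim_lie :: "'a graded_lie \<Rightarrow> bool" where
  "fin_dim_lie L \<longleftrightarrow> vectorspace.fin_dim rat_field L"

definition finite_type :: "'a graded_lie \<Rightarrow> bool" where
  "finite_type L \<longleftrightarrow> (\<forall>n. vectorspace.fin_dim rat_field (L\<lparr>carrier := part L n\<rparr>))"

text \<open>Iterated brackets of a given length are taken with an arbitrary placement of brackets.\<close>

inductive iterated_bracket :: "'a graded_lie \<Rightarrow> nat \<Rightarrow> 'a \<Rightarrow> bool" for L where
  single: "x \<in> carrier L \<Longrightarrow> iterated_bracket L 1 x"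
| bracket: "iterated_bracket L i x \<Longrightarrow> iterated_bracket L j y \<Longrightarrow>
    iterated_bracket L (i + j) (bracket L x y)"

text \<open>Meaningful for \<open>k \<ge> 1\<close> only; the value at \<open>0\<close> is the zero subspace.\<close>

definition lie_power :: "'a graded_lie \<Rightarrow> nat \<Rightarrow> 'a set" where
  "lie_power L k = lin_span L {x. iterated_bracket L k x}"

definition nilpotent_lie :: "'a graded_lie \<Rightarrow> bool" where
  "nilpotent_lie L \<longleftrightarrow> (\<exists>k\<ge>1. lie_power L k = {\<zero>\<^bsub>L\<^esub>})"

text \<open>
  A family of ideals enters every notion below only through its set of members, so it is given as
  a set. A directed family is nonempty; without this requirement the zero algebra would also
  carry the empty family.
\<close>

definition enriched_lie :: "'a graded_lie \<Rightarrow> 'a set set \<Rightarrow> bool" where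
  "enriched_lie L \<I> \<longleftrightarrow>
     graded_lie_algebra L \<and>
     \<I> \<noteq> {} \<and>
     (\<forall>I\<in>\<I>. graded_ideal L I \<and> fin_dim_lie (quotient_lie L I) \<and> nilpotent_lie (quotient_lie L I)) \<and>
     (\<forall>I\<in>\<I>. \<forall>J\<in>\<I>. \<exists>K\<in>\<I>. K \<subseteq> I \<inter> J) \<and>
     \<Inter>\<I> = {\<zero>\<^bsub>L\<^esub>}"

text \<open>
  The degree \<open>n\<close> part of the inverse limit of the quotients \<open>L / I\<close>. For \<open>J \<subseteq> I\<close> the set
  \<open>I <+> X\<close> is the image of the coset \<open>X\<close> of \<open>J\<close> under the projection \<open>L / J \<rightarrow> L / I\<close>.
\<close>

definition limit_part :: "'a graded_lie \<Rightarrow> 'a set set \<Rightarrow> nat \<Rightarrow> ('a set \<Rightarrow> 'a set) set" where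
  "limit_part L \<I> n =
     {\<xi> \<in> (\<Pi>\<^sub>E I\<in>\<I>. part (quotient_lie L I) n).
        \<forall>I\<in>\<I>. \<forall>J\<in>\<I>. J \<subseteq> I \<longrightarrow> I <+>\<^bsub>L\<^esub> \<xi> J = \<xi> I}"

text \<open>
  The natural map to the limit preserves all operations, so it is an isomorphism of graded Lie
  algebras if and only if it is bijective in each degree.
\<close>

definition complete_enriched_lie :: "'a graded_lie \<Rightarrow> 'a set set \<Rightarrow> bool" where
  "complete_enriched_lie L \<I> \<longleftrightarrow>
     enriched_lie L \<I> \<and>
     (\<forall>n. bij_betw (\<lambda>x. \<lambda>I\<in>\<I>. I +>\<^bsub>L\<^esub> x) (part L n) (limit_part L \<I> n))"

definition graded_lie_hom :: "'a graded_lie \<Rightarrow> 'b graded_lie \<Rightarrow> ('a \<Rightarrow> 'b) set" where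
  "graded_lie_hom E F =
     {\<phi> \<in> module_hom rat_field E F.
        (\<forall>n. \<phi> ` part E n \<subseteq> part F n) \<and>
        (\<forall>x\<in>carrier E. \<forall>y\<in>carrier E. \<phi> (bracket E x y) = bracket F (\<phi> x) (\<phi> y))}"

definition enriched_morphism ::
    "'a graded_lie \<Rightarrow> 'a set set \<Rightarrow> 'b graded_lie \<Rightarrow> 'b set set \<Rightarrow> ('a \<Rightarrow> 'b) \<Rightarrow> bool" where
  "enriched_morphism E \<J> F \<I> \<phi> \<longleftrightarrow>
     enriched_lie E \<J> \<and> enriched_lie F \<I> \<and> \<phi> \<in> graded_lie_hom E F \<and>
     (\<forall>I\<in>\<I>. \<exists>J\<in>\<J>. J \<subseteq> {x \<in> carrier E. \<phi> x \<in> I})"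

definition equivalent_structures :: "'a graded_lie \<Rightarrow> 'a set set \<Rightarrow> 'a set set \<Rightarrow> bool" where
  "equivalent_structures L \<I> \<I>' \<longleftrightarrow>
     enriched_morphism L \<I> L \<I>' id \<and> enriched_morphism L \<I>' L \<I> id"

definition part_from :: "'a graded_lie \<Rightarrow> nat \<Rightarrow> 'a set" where
  "part_from L k = lin_span L (\<Union>i\<in>{k..}. part L i)"

definition canonical_ideal :: "'a graded_lie \<Rightarrow> nat \<Rightarrow> 'a set" where
  "canonical_ideal L k = lie_power L k <+>\<^bsub>L\<^esub> part_from L k"

definition canonical_structure :: "'a graded_lie \<Rightarrow> 'a set set" where
  "canonical_structure L = {canonical_ideal L k |k. k \<ge> 1}"

end

theory Submission
  imports Defs
begin

text \<open>
  Write \<open>I\<^sub>k = L\<^sup>k + L\<^bsub>\<ge>k\<^esub>\<close>. Let \<open>\<J>\<close> be any family of ideals that makes \<open>L\<close> an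
  enriched Lie algebra. A member \<open>I\<close> of \<open>\<J>\<close> has a finite dimensional nilpotent quotient, so it contains
  both a power \<open>L\<^sup>k\<close> and all parts of large degree, hence some \<open>I\<^sub>k\<close>
  (\<open>enriched_contains_canonical\<close>). In particular the \<open>I\<^sub>k\<close> intersect in zero. Two things remain: each
  \<open>L / I\<^sub>k\<close> is finite dimensional, and each \<open>I\<^sub>k\<close> contains a member of \<open>\<J>\<close>.

  The first is algebra. Choose finite sets \<open>V\<^sub>n\<close> in degree \<open>n\<close> that span \<open>L\<close> modulo \<open>L\<^sup>2\<close>. By the Jacobi
  identity \<open>L\<^bsup>k+1\<^esup> = [L, L\<^sup>k]\<close>, and replacing the left factor by the \<open>V\<^sub>i\<close> costs only an error in
  \<open>L\<^bsup>k+2\<^esup>\<close> (\<open>left_power_step\<close>). In degree \<open>n\<close> only finitely many \<open>V\<^sub>i\<close> occur because the grading is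
  by natural numbers, so every \<open>L\<^sup>k\<close> has finite codimension in every degree.

  The second is a compactness argument. A vector space that is complete for a filtration by subspaces of
  finite codimension is linearly compact; the form used here is that it is complete for every coarser
  filtration as well (\<open>complete_coarser\<close>). Consequently the image of a closed subspace under a map
  \<open>[v, _]\<close> is closed, and so is a finite sum of closed subspaces. For the given complete structure this
  shows that \<open>L\<^sup>k\<close> is closed in each degree (\<open>closed_in_left_power\<close>): the finite sum
  \<open>T = \<Sum>[V\<^sub>i, L\<^sup>k]\<close> is closed by induction, and iterating the above step shows
  \<open>L\<^bsup>k+1\<^esup> \<subseteq> T + L\<^sup>r\<close> for all \<open>r\<close>, so \<open>L\<^bsup>k+1\<^esup>\<close> lies in the closure of \<open>T\<close> and equals \<open>T\<close>.
  Hence \<open>I\<^sub>k\<close> is closed, that is, the intersection of all \<open>I + I\<^sub>k\<close>. These sums form a directed family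
  above \<open>I\<^sub>k\<close>, so the family has a least member because \<open>L / I\<^sub>k\<close> is finite dimensional; this
  member is \<open>I\<^sub>k\<close> itself, and so \<open>I \<subseteq> I\<^sub>k\<close> for some \<open>I\<close>.

  It follows that \<open>L\<close> is complete in each degree for the \<open>I\<^sub>k\<close> themselves. For an arbitrary family
  \<open>\<J>\<close> take \<open>I\<close> in \<open>\<J>\<close> with \<open>I + I\<^sub>k\<close> least and a homogeneous \<open>y\<close> in \<open>I\<close>. For each \<open>m\<close> the
  element \<open>y\<close> is congruent modulo \<open>I\<^sub>k\<close> to some \<open>c\<^sub>m\<close> that lies in all \<open>J + I\<^sub>m\<close>. A limit of the
  \<open>c\<^sub>m\<close> lies in every \<open>J\<close>, so it is zero, and therefore \<open>y\<close> is in \<open>I\<^sub>k\<close>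
  (\<open>enriched_below_canonical\<close>). This is the familiar fact that a compact topology has no strictly coarser
  Hausdorff topology.
\<close>

section \<open>Subspaces and finite codimension\<close>

no_notation Sum_Type.Plus (infixr \<open><+>\<close> 65)

lemma rat_field_simps [simp]:
  "carrier rat_field = UNIV" "\<zero>\<^bsub>rat_field\<^esub> = 0" "\<one>\<^bsub>rat_field\<^esub> = 1"
  "c \<oplus>\<^bsub>rat_field\<^esub> d = c + d" "c \<otimes>\<^bsub>rat_field\<^esub> d = c * d"
  by (simp_all add: rat_field_def)

locale lie_algebra = graded_lie_algebra L for L :: "'a graded_lie" (structure)
begin

abbreviation subsp :: "'a set \<Rightarrow> bool" where
  "subsp S \<equiv> subspace rat_field S L"

abbreviation sp :: "'a set \<Rightarrow> 'a set" where
  "sp S \<equiv> lin_span L S"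

lemma subsp_iff:
  "subsp S \<longleftrightarrow> S \<subseteq> carrier L \<and> \<zero> \<in> S \<and> (\<forall>x\<in>S. \<forall>y\<in>S. x \<oplus> y \<in> S) \<and> (\<forall>c. \<forall>x\<in>S. c \<odot> x \<in> S)"
  using vectorspace_axioms module_axioms unfolding subspace_def submodule_def by auto

lemma subspI:
  assumes "S \<subseteq> carrier L" "\<zero> \<in> S" "\<And>x y. x \<in> S \<Longrightarrow> y \<in> S \<Longrightarrow> x \<oplus> y \<in> S"
    "\<And>c x. x \<in> S \<Longrightarrow> c \<odot> x \<in> S"
  shows "subsp S"
  using assms by (simp add: subsp_iff)

lemma subspD:
  assumes "subsp S"
  shows "S \<subseteq> carrier L" "x \<in> S \<Longrightarrow> x \<in> carrier L" "\<zero> \<in> S"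
    "x \<in> S \<Longrightarrow> y \<in> S \<Longrightarrow> x \<oplus> y \<in> S" "x \<in> S \<Longrightarrow> c \<odot> x \<in> S"
  using assms by (auto simp: subsp_iff)

lemma smult_cl [simp]: "x \<in> carrier L \<Longrightarrow> c \<odot> x \<in> carrier L"
  by simp

lemma smult_minus_one: "x \<in> carrier L \<Longrightarrow> (- 1) \<odot> x = \<ominus> x"
proof -
  assume x: "x \<in> carrier L"
  have "(- 1) \<odot> x \<oplus> 1 \<odot> x = \<zero>"
    using smult_l_distr[of "- 1" 1 x] smult_l_null[OF x] x by simp
  moreover have "1 \<odot> x = x" using smult_one[OF x] by simp
  ultimately show ?thesis using x by (simp add: M.minus_equality)
qed

lemma subsp_minus: "subsp S \<Longrightarrow> x \<in> S \<Longrightarrow> \<ominus> x \<in> S"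
  using subspD(5)[of S x "- 1"] smult_minus_one subspD(2) by metis

lemma subsp_diff: "subsp S \<Longrightarrow> x \<in> S \<Longrightarrow> y \<in> S \<Longrightarrow> x \<ominus> y \<in> S"
  by (simp add: M.minus_eq subsp_minus subspD)

lemma add_cancel [simp]:
  assumes "x \<in> carrier L" "y \<in> carrier L"
  shows "x \<oplus> (y \<oplus> \<ominus> x) = y" "\<ominus> x \<oplus> (y \<oplus> x) = y"
  using assms M.a_lcomm[of x y "\<ominus> x"] M.a_lcomm[of "\<ominus> x" y x] by (simp_all add: M.r_neg M.l_neg)

lemma diff_arith:
  assumes "x \<in> carrier L" "y \<in> carrier L"
  shows "(x \<ominus> y) \<oplus> y = x" "(x \<oplus> y) \<ominus> y = x" "(x \<oplus> y) \<ominus> x = y" "\<ominus> (x \<ominus> y) = y \<ominus> x" "x \<ominus> (x \<ominus> y) = y"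
    "y \<oplus> (x \<ominus> y) = x"
  using assms by (simp_all add: M.minus_eq M.a_ac M.minus_add M.r_neg M.r_neg1 M.r_neg2 M.l_neg)

lemma diff_self [simp]: "x \<in> carrier L \<Longrightarrow> x \<ominus> x = \<zero>"
  and diff_zero [simp]: "x \<in> carrier L \<Longrightarrow> x \<ominus> \<zero> = x"
  by (simp_all add: M.minus_eq M.r_neg)

lemma diff_diff:
  assumes "x \<in> carrier L" "y \<in> carrier L" "z \<in> carrier L"
  shows "(x \<ominus> y) \<oplus> (y \<ominus> z) = x \<ominus> z" "(x \<ominus> z) \<ominus> (y \<ominus> z) = x \<ominus> y" "(x \<ominus> y) \<ominus> (x \<ominus> z) = z \<ominus> y"
  using assms by (simp_all add: M.minus_eq M.a_ac M.minus_add M.r_neg M.r_neg1 M.r_neg2 M.l_neg)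

lemma diff_add:
  assumes "x \<in> carrier L" "y \<in> carrier L" "z \<in> carrier L" "w \<in> carrier L"
  shows "(x \<oplus> y) \<ominus> (z \<oplus> w) = (x \<ominus> z) \<oplus> (y \<ominus> w)"
    "(x \<ominus> y) \<ominus> (z \<ominus> w) = (x \<ominus> z) \<ominus> (y \<ominus> w)"
  using assms by (simp_all add: M.minus_eq M.a_ac M.minus_add M.r_neg M.r_neg1 M.r_neg2 M.l_neg)

lemma diff_smult:
  assumes "x \<in> carrier L" "y \<in> carrier L"
  shows "c \<odot> (x \<ominus> y) = c \<odot> x \<ominus> c \<odot> y"
  using assms by (simp add: M.minus_eq smult_r_distr smult_r_minus)

lemma subsp_diff_trans:
  assumes "subsp S" "x \<in> carrier L" "y \<in> carrier L" "z \<in> carrier L" "x \<ominus> y \<in> S" "y \<ominus> z \<in> S"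
  shows "x \<ominus> z \<in> S"
  using subspD(4)[OF assms(1,5,6)] diff_diff(1)[of x y z] assms by simp

lemma subsp_diff_sym:
  assumes "subsp S" "x \<in> carrier L" "y \<in> carrier L" "x \<ominus> y \<in> S"
  shows "y \<ominus> x \<in> S"
  using subsp_minus[OF assms(1,4)] diff_arith(4)[of x y] assms by simp

lemma subsp_diff_mem:
  assumes "subsp S" "x \<in> carrier L" "x \<ominus> y \<in> S" "y \<in> S"
  shows "x \<in> S"
  using subspD(4)[OF assms(1,3,4)] diff_arith(1)[of x y] assms subspD(2)[OF assms(1,4)] by simp

lemma subsp_carrier: "subsp (carrier L)"
  by (rule subspI) auto

lemma subsp_zero: "subsp {\<zero>}"
  by (rule subspI) (auto simp: smult_r_null)

lemma subsp_Int: "subsp S \<Longrightarrow> subsp T \<Longrightarrow> subsp (S \<inter> T)"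
  by (auto simp: subsp_iff)

lemma subsp_Inter: "\<S> \<noteq> {} \<Longrightarrow> (\<And>S. S \<in> \<S> \<Longrightarrow> subsp S) \<Longrightarrow> subsp (\<Inter>\<S>)"
  unfolding subsp_iff by blast

lemma sp_subspace: "S \<subseteq> carrier L \<Longrightarrow> subsp (sp S)"
  by (simp add: lin_span_def span_is_subspace)

lemma sp_superset: "S \<subseteq> carrier L \<Longrightarrow> S \<subseteq> sp S"
  by (simp add: lin_span_def in_own_span)

lemma sp_least: "S \<subseteq> T \<Longrightarrow> subsp T \<Longrightarrow> sp S \<subseteq> T"
  by (simp add: lin_span_def span_is_subset subspace_def)

lemma sp_mono: "S \<subseteq> T \<Longrightarrow> T \<subseteq> carrier L \<Longrightarrow> sp S \<subseteq> sp T"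
  by (meson sp_least sp_subspace sp_superset subset_trans)

lemma sp_eq: "subsp S \<Longrightarrow> sp S = S"
  using sp_least[of S S] sp_superset[of S] subspD(1) by auto

text \<open>
  A sum is used through one summand and a congruence modulo the other, which turns statements about
  sums into closure of a subspace under differences.
\<close>

lemma mem_sum:
  assumes "subsp S" "subsp T"
  shows "x \<in> S <+> T \<longleftrightarrow> x \<in> carrier L \<and> (\<exists>s\<in>S. x \<ominus> s \<in> T)"
proof
  assume "x \<in> S <+> T"
  then obtain s t where "s \<in> S" "t \<in> T" "x = s \<oplus> t"
    by (auto simp: set_add_def')
  then show "x \<in> carrier L \<and> (\<exists>s\<in>S. x \<ominus> s \<in> T)"
    using assms subspD(2) by (metis M.a_closed diff_arith(3))
next
  assume "x \<in> carrier L \<and> (\<exists>s\<in>S. x \<ominus> s \<in> T)"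
  then obtain s where "x \<in> carrier L" "s \<in> S" "x \<ominus> s \<in> T" by blast
  moreover from this have "x = s \<oplus> (x \<ominus> s)"
    using assms subspD(2) by (simp add: diff_arith)
  ultimately show "x \<in> S <+> T" unfolding set_add_def' by blast
qed

lemma sumI: "subsp S \<Longrightarrow> subsp T \<Longrightarrow> x \<in> carrier L \<Longrightarrow> s \<in> S \<Longrightarrow> x \<ominus> s \<in> T \<Longrightarrow> x \<in> S <+> T"
  by (auto simp: mem_sum)

lemma subsp_sum:
  assumes S: "subsp S" and T: "subsp T"
  shows "subsp (S <+> T)"
proof (rule subspI)
  show "S <+> T \<subseteq> carrier L" using mem_sum[OF assms] by blast
  show "\<zero> \<in> S <+> T"
    using sumI[OF assms, of \<zero> \<zero>] subspD(3)[OF S] subspD(3)[OF T] by (simp add: diff_arith)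
next
  fix x y assume x: "x \<in> S <+> T" and y: "y \<in> S <+> T"
  then obtain s t where st: "s \<in> S" "x \<ominus> s \<in> T" "t \<in> S" "y \<ominus> t \<in> T" "x \<in> carrier L" "y \<in> carrier L"
    using mem_sum[OF assms] by blast
  then have "(x \<oplus> y) \<ominus> (s \<oplus> t) \<in> T"
    using subspD(2)[OF S] by (simp add: diff_add subspD[OF T])
  then show "x \<oplus> y \<in> S <+> T"
    using st by (intro sumI[OF assms, of _ "s \<oplus> t"]) (auto simp: subspD[OF S])
next
  fix c x assume x: "x \<in> S <+> T"
  then obtain s where s: "s \<in> S" "x \<ominus> s \<in> T" "x \<in> carrier L"
    using mem_sum[OF assms] by blast
  then have "c \<odot> x \<ominus> c \<odot> s \<in> T"
    using subspD(2)[OF S] subspD(5)[OF T, of "x \<ominus> s" c] by (simp add: diff_smult)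
  then show "c \<odot> x \<in> S <+> T"
    using s by (intro sumI[OF assms, of _ "c \<odot> s"]) (auto simp: subspD[OF S])
qed

lemma sum_upper:
  assumes "subsp S" "subsp T"
  shows "S \<subseteq> S <+> T" "T \<subseteq> S <+> T"
proof -
  show "S \<subseteq> S <+> T"
    using subspD[OF assms(1)] subspD(3)[OF assms(2)]
    by (auto intro: sumI[OF assms])
  show "T \<subseteq> S <+> T"
    using subspD[OF assms(2)] subspD(3)[OF assms(1)]
    by (auto intro: sumI[OF assms, of _ \<zero>])
qed

lemma sum_least:
  assumes "subsp S" "subsp T" "subsp U" "S \<subseteq> U" "T \<subseteq> U"
  shows "S <+> T \<subseteq> U"
  using mem_sum[OF assms(1,2)] assms(4,5) subsp_diff_mem[OF assms(3)] by blast

lemma sum_mono: "S \<subseteq> S' \<Longrightarrow> T \<subseteq> T' \<Longrightarrow> S <+> T \<subseteq> S' <+> T'"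
  unfolding set_add_def' by blast

lemma sp_Un:
  assumes "S \<subseteq> carrier L" "T \<subseteq> carrier L"
  shows "sp (S \<union> T) = sp S <+> sp T"
proof
  note sub = sp_subspace[OF assms(1)] sp_subspace[OF assms(2)]
  show "sp (S \<union> T) \<subseteq> sp S <+> sp T"
    using sum_upper[OF sub] sp_superset[OF assms(1)] sp_superset[OF assms(2)]
    by (intro sp_least subsp_sum sub) auto
  show "sp S <+> sp T \<subseteq> sp (S \<union> T)"
    using assms by (intro sum_least sub sp_subspace sp_mono) auto
qed

lemma sp_insert:
  assumes "S \<subseteq> carrier L" "f \<in> carrier L" "x \<in> sp (insert f S)"
  shows "\<exists>c. x \<ominus> c \<odot> f \<in> sp S"
proof -
  note sub = sp_subspace[OF assms(1)]
  have line: "subsp (range (\<lambda>c. c \<odot> f))"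
  proof (rule subspI)
    show "\<zero> \<in> range (\<lambda>c. c \<odot> f)"
      using smult_l_null[OF assms(2)] by (metis rangeI rat_field_simps(2))
    fix x y assume "x \<in> range (\<lambda>c. c \<odot> f)" "y \<in> range (\<lambda>c. c \<odot> f)"
    then show "x \<oplus> y \<in> range (\<lambda>c. c \<odot> f)"
      using smult_l_distr[OF _ _ assms(2)] by (auto simp: image_def) metis
  next
    fix c x assume "x \<in> range (\<lambda>c. c \<odot> f)"
    then show "c \<odot> x \<in> range (\<lambda>c. c \<odot> f)"
      using smult_assoc1[OF _ _ assms(2)] by (auto simp: image_def) metis
  qed (use assms in auto)
  have "f \<in> range (\<lambda>c. c \<odot> f)"
    using smult_one[OF assms(2)] by (metis rangeI rat_field_simps(3))
  then have "insert f S \<subseteq> range (\<lambda>c. c \<odot> f) <+> sp S"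
    using sum_upper[OF line sub] sp_superset[OF assms(1)] by auto
  then have "x \<in> range (\<lambda>c. c \<odot> f) <+> sp S"
    using sp_least[OF _ subsp_sum[OF line sub]] assms(3) by blast
  then show ?thesis using mem_sum[OF line sub] by blast
qed

definition finite_over :: "'a set \<Rightarrow> 'a set \<Rightarrow> bool" where
  "finite_over U W \<longleftrightarrow> (\<exists>F. finite F \<and> F \<subseteq> carrier L \<and> W \<subseteq> sp (U \<union> F))"

lemma finite_over_refl: "U \<subseteq> carrier L \<Longrightarrow> finite_over U U"
  unfolding finite_over_def using sp_superset[of U] by (intro exI[of _ "{}"]) auto

lemma finite_over_trans:
  assumes "U \<subseteq> carrier L" "finite_over U V" "finite_over V W"
  shows "finite_over U W"
proof -
  obtain F where F: "finite F" "F \<subseteq> carrier L" "V \<subseteq> sp (U \<union> F)"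
    using assms(2) unfolding finite_over_def by blast
  obtain E where E: "finite E" "E \<subseteq> carrier L" "W \<subseteq> sp (V \<union> E)"
    using assms(3) unfolding finite_over_def by blast
  have c: "U \<union> (F \<union> E) \<subseteq> carrier L" using assms(1) F(2) E(2) by blast
  have "V \<union> E \<subseteq> sp (U \<union> (F \<union> E))"
    using F(3) sp_mono[of "U \<union> F" "U \<union> (F \<union> E)"] c sp_superset[OF c] by blast
  then have "sp (V \<union> E) \<subseteq> sp (U \<union> (F \<union> E))" by (intro sp_least sp_subspace c)
  then show ?thesis using F E unfolding finite_over_def by (intro exI[of _ "F \<union> E"]) auto
qed

lemma finite_over_mono:
  assumes "U' \<subseteq> carrier L" "U \<subseteq> U'" "W' \<subseteq> W" "finite_over U W"
  shows "finite_over U' W'"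
proof -
  obtain F where F: "finite F" "F \<subseteq> carrier L" "W \<subseteq> sp (U \<union> F)"
    using assms(4) unfolding finite_over_def by blast
  moreover have "sp (U \<union> F) \<subseteq> sp (U' \<union> F)"
    using assms F(2) by (intro sp_mono) auto
  ultimately show ?thesis using assms(3) unfolding finite_over_def by blast
qed

text \<open>
  Induction on the number of generators over \<open>U\<close>. When a generator \<open>f\<close> is added to the span \<open>W\<close>, either some member
  meets the larger span only inside \<open>W\<close> and nothing changes, or every member contains a vector with a
  nonzero \<open>f\<close>-coefficient. In that case a multiple of such a vector, taken from a smaller member, moves any
  given vector of the old minimum into \<open>W\<close>.
\<close>

lemma directed_minimum_above:
  assumes F: "finite F" "F \<subseteq> carrier L" and U: "subsp U"
    and ne: "\<S> \<noteq> {}" and sub: "\<And>S. S \<in> \<S> \<Longrightarrow> subsp S" and above: "\<And>S. S \<in> \<S> \<Longrightarrow> U \<subseteq> S"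
    and dir: "\<And>S T. S \<in> \<S> \<Longrightarrow> T \<in> \<S> \<Longrightarrow> \<exists>R\<in>\<S>. R \<subseteq> S \<inter> T"
  shows "\<exists>S\<in>\<S>. \<forall>T\<in>\<S>. S \<inter> sp (U \<union> F) \<subseteq> T"
  using F
proof (induction F)
  case empty
  then show ?case using ne above by (simp add: sp_eq[OF U]) blast
next
  case (insert f F)
  define W where "W = sp (U \<union> F)"
  define W' where "W' = sp (U \<union> insert f F)"
  have c: "U \<union> F \<subseteq> carrier L" "f \<in> carrier L" "U \<union> insert f F = insert f (U \<union> F)"
    using insert subspD(1)[OF U] by auto
  have W: "subsp W" unfolding W_def by (rule sp_subspace[OF c(1)])
  have W': "W' \<subseteq> carrier L"
    unfolding W'_def using c by (intro subspD(1)[OF sp_subspace]) auto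
  obtain S0 where S0: "S0 \<in> \<S>" "\<And>T. T \<in> \<S> \<Longrightarrow> S0 \<inter> W \<subseteq> T"
    using insert unfolding W_def by blast
  show ?case
  proof (cases "\<exists>S1\<in>\<S>. S1 \<inter> W' \<subseteq> W")
    case True
    then obtain S1 where S1: "S1 \<in> \<S>" "S1 \<inter> W' \<subseteq> W" by blast
    obtain S2 where "S2 \<in> \<S>" "S2 \<subseteq> S0 \<inter> S1" using dir[OF S0(1) S1(1)] by blast
    then show ?thesis using S0(2) S1(2) unfolding W'_def[symmetric] by blast
  next
    case False
    have "s \<in> T" if T: "T \<in> \<S>" and s: "s \<in> S0" "s \<in> W'" for s T
    proof -
      obtain T' where T': "T' \<in> \<S>" "T' \<subseteq> S0 \<inter> T" using dir[OF S0(1) T] by blast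
      obtain t where t: "t \<in> T'" "t \<in> W'" "t \<notin> W" using False T' by blast
      have carr: "s \<in> carrier L" "t \<in> carrier L" using s t W' by auto
      obtain a where a: "s \<ominus> a \<odot> f \<in> W"
        using sp_insert[OF c(1,2)] s(2) c(3) unfolding W'_def W_def by auto
      obtain b where b: "t \<ominus> b \<odot> f \<in> W"
        using sp_insert[OF c(1,2)] t(2) c(3) unfolding W'_def W_def by auto
      have "b \<noteq> 0"
      proof
        assume "b = 0"
        then have "b \<odot> f = \<zero>" using smult_l_null[OF c(2)] by simp
        then show False using b t(3) carr by (simp add: diff_arith)
      qed
      define q where "q = a / b"
      have "q \<odot> (b \<odot> f) = a \<odot> f"
        using smult_assoc1[OF _ _ c(2), of q b] \<open>b \<noteq> 0\<close> by (simp add: q_def)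
      then have "q \<odot> t \<ominus> a \<odot> f \<in> W"
        using subspD(5)[OF W b, of q] carr c(2) by (simp add: diff_smult)
      then have "s \<ominus> q \<odot> t \<in> W"
        using subsp_diff_trans[OF W _ _ _ a subsp_diff_sym[OF W]] carr c(2) by simp
      moreover have "s \<ominus> q \<odot> t \<in> S0"
        using s t T' sub[OF S0(1)] by (intro subsp_diff) (auto simp: subspD)
      ultimately have "s \<ominus> q \<odot> t \<in> T" using S0(2)[OF T] by blast
      moreover have "q \<odot> t \<in> T" using t T' sub[OF T] by (auto simp: subspD)
      ultimately show ?thesis using subsp_diff_mem[OF sub[OF T]] carr by blast
    qed
    then show ?thesis using S0(1) unfolding W'_def by blast
  qed
qed

lemma directed_minimum:
  assumes fin: "finite_over U W" and U: "subsp U"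
    and ne: "\<S> \<noteq> {}" and sub: "\<And>S. S \<in> \<S> \<Longrightarrow> subsp S"
    and dir: "\<And>S T. S \<in> \<S> \<Longrightarrow> T \<in> \<S> \<Longrightarrow> \<exists>R\<in>\<S>. R \<subseteq> S \<inter> T"
  shows "\<exists>S\<in>\<S>. \<forall>T\<in>\<S>. (S <+> U) \<inter> W \<subseteq> T <+> U"
proof -
  obtain F where F: "finite F" "F \<subseteq> carrier L" "W \<subseteq> sp (U \<union> F)"
    using fin unfolding finite_over_def by blast
  have "\<exists>S\<in>(\<lambda>S. S <+> U) ` \<S>. \<forall>T\<in>(\<lambda>S. S <+> U) ` \<S>. S \<inter> sp (U \<union> F) \<subseteq> T"
  proof (rule directed_minimum_above[OF F(1,2) U])
    fix S T assume "S \<in> (\<lambda>S. S <+> U) ` \<S>" "T \<in> (\<lambda>S. S <+> U) ` \<S>"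
    then obtain S' T' where S': "S' \<in> \<S>" "S = S' <+> U" and T': "T' \<in> \<S>" "T = T' <+> U" by blast
    obtain R where "R \<in> \<S>" "R \<subseteq> S' \<inter> T'" using dir[OF S'(1) T'(1)] by blast
    then show "\<exists>R\<in>(\<lambda>S. S <+> U) ` \<S>. R \<subseteq> S \<inter> T"
      unfolding S'(2) T'(2) by (intro bexI[of _ "R <+> U"]) (auto intro: sum_mono[THEN subsetD])
  qed (use ne sub U in \<open>auto intro: subsp_sum simp: sum_upper[THEN subsetD]\<close>)
  then show ?thesis using F(3) by blast
qed

text \<open>
  Completeness for the topology with the \<open>A k\<close> as neighbourhoods of zero. For a decreasing filtration,
  consecutive differences suffice to express the Cauchy condition with a prescribed rate, and the limit
  satisfies the same rate.
\<close>

definition complete_wrt :: "'a set \<Rightarrow> (nat \<Rightarrow> 'a set) \<Rightarrow> bool" where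
  "complete_wrt W A \<longleftrightarrow>
     (\<forall>c. (\<forall>k. c k \<in> W) \<longrightarrow> (\<forall>k. c (Suc k) \<ominus> c k \<in> A k) \<longrightarrow> (\<exists>x\<in>W. \<forall>k. x \<ominus> c k \<in> A k))"

lemma telescope:
  assumes D: "\<And>k. subsp (D k)" "\<And>k. D (Suc k) \<subseteq> D k"
    and c: "\<And>k. c k \<in> carrier L" "\<And>k. c (Suc k) \<ominus> c k \<in> D k" and "m \<le> n"
  shows "c n \<ominus> c m \<in> D m"
  using \<open>m \<le> n\<close>
proof (induction n rule: dec_induct)
  case base
  then show ?case using c(1) subspD(3)[OF D(1)] by simp
next
  case (step n)
  have "D n \<subseteq> D m" using lift_Suc_antimono_le[of D m n] D(2) step by blast
  then show ?case
    using subsp_diff_trans[OF D(1), of "c (Suc n)" "c n" "c m" m] c step by blast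
qed

text \<open>
  This is linear compactness. A Cauchy sequence for \<open>D\<close> is the same as a decreasing sequence of affine
  subspaces \<open>c m + D m\<close>, and a limit is a common point. Modulo \<open>A k\<close> these affine spaces live in
  finite dimension, so their images become stationary; the preimage of the stable image is the set
  \<open>T k\<close> below. Each point of \<open>T k\<close> lifts to \<open>T (Suc k)\<close> up to \<open>A k\<close>, which produces a Cauchy sequence
  for \<open>A\<close>, and its limit is a common point because \<open>A k\<close> is contained in \<open>D k\<close>.
\<close>

lemma complete_coarser:
  assumes W: "subsp W" and A: "\<And>k. subsp (A k)" and D: "\<And>k. subsp (D k)"
    and AD: "\<And>k. A k \<subseteq> D k" and DW: "\<And>k. D k \<subseteq> W"
    and D_dec: "\<And>k. D (Suc k) \<subseteq> D k"
    and fin: "\<And>k. finite_over (A k) W" and complete: "complete_wrt W A"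
  shows "complete_wrt W D"
  unfolding complete_wrt_def
proof (intro allI impI)
  fix c assume cW: "\<forall>k. c k \<in> W" and cD: "\<forall>k. c (Suc k) \<ominus> c k \<in> D k"
  have car: "x \<in> carrier L" if "x \<in> W" for x using subspD(2)[OF W that] .
  have c_diff: "c n \<ominus> c m \<in> D m" if "m \<le> n" for m n
    using telescope[of D c m n] D D_dec cW cD car that by blast
  have D_anti: "D n \<subseteq> D m" if "m \<le> n" for m n
    using lift_Suc_antimono_le[of D m n] D_dec that by blast
  define T where "T k = {x \<in> W. \<forall>m. \<exists>s\<in>W. s \<ominus> c m \<in> D m \<and> x \<ominus> s \<in> A k}" for k
  have stable: "\<exists>m. \<forall>s\<in>W. s \<ominus> c m \<in> D m \<longrightarrow> s \<in> T k" for k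
  proof -
    have "\<exists>S\<in>range D. \<forall>T\<in>range D. (S <+> A k) \<inter> W \<subseteq> T <+> A k"
    proof (rule directed_minimum[OF fin A])
      fix S T assume "S \<in> range D" "T \<in> range D"
      then obtain m n where "S = D m" "T = D n" by blast
      then show "\<exists>R\<in>range D. R \<subseteq> S \<inter> T"
        using D_anti[of m "max m n"] D_anti[of n "max m n"] by auto
    qed (use D in auto)
    then obtain m where m: "\<And>n. (D m <+> A k) \<inter> W \<subseteq> D n <+> A k" by blast
    have "s \<in> T k" if s: "s \<in> W" "s \<ominus> c m \<in> D m" for s
    proof -
      have "\<exists>r\<in>W. r \<ominus> c n \<in> D n \<and> s \<ominus> r \<in> A k" for n
      proof (cases "n \<le> m")
        case True
        then have "s \<ominus> c n \<in> D n"
          using subsp_diff_trans[OF D, of s "c m" "c n" n] s car cW c_diff D_anti by blast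
        moreover have "s \<ominus> s \<in> A k" using s car subspD(3)[OF A] by (simp add: diff_arith)
        ultimately show ?thesis using s by blast
      next
        case False
        (* Here n > m, and D m is stable modulo A k: the difference can be corrected inside D n. *)
        have "s \<ominus> c n \<in> D m"
          using subsp_diff_trans[OF D, of s "c m" "c n" m] s car cW c_diff[of m n] False
            subsp_diff_sym[OF D] by (meson nat_le_linear)
        then have "s \<ominus> c n \<in> D n <+> A k"
          using m sum_upper(1)[OF D A] DW by blast
        then obtain d where d: "d \<in> D n" "(s \<ominus> c n) \<ominus> d \<in> A k"
          using mem_sum[OF D A] by blast
        have dc: "d \<in> carrier L" "c n \<in> carrier L" "s \<in> carrier L"
          using d car cW s DW by blast+
        have "(s \<ominus> c n) \<ominus> d = s \<ominus> (c n \<oplus> d)"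
          using dc by (simp add: M.minus_eq M.a_ac M.minus_add)
        moreover have "c n \<oplus> d \<in> W" using d DW cW by (auto intro: subspD(4)[OF W])
        moreover have "(c n \<oplus> d) \<ominus> c n \<in> D n" using d dc by (simp add: diff_arith)
        ultimately have "s \<ominus> (c n \<oplus> d) \<in> A k" "c n \<oplus> d \<in> W" "(c n \<oplus> d) \<ominus> c n \<in> D n"
          using d by simp_all
        then show ?thesis by blast
      qed
      then show ?thesis using s(1) unfolding T_def by blast
    qed
    then show ?thesis by blast
  qed
  have "\<exists>x. \<forall>k. x k \<in> T k \<and> x (Suc k) \<ominus> x k \<in> A k"
  proof (rule dependent_nat_choice)
    obtain m where "\<forall>s\<in>W. s \<ominus> c m \<in> D m \<longrightarrow> s \<in> T 0" using stable by blast
    moreover have "c m \<ominus> c m \<in> D m" using c_diff[of m m] by simp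
    ultimately show "\<exists>x. x \<in> T 0" using cW by blast
  next
    fix x k assume x: "x \<in> T k"
    obtain m where m: "\<forall>s\<in>W. s \<ominus> c m \<in> D m \<longrightarrow> s \<in> T (Suc k)" using stable by blast
    obtain s where "s \<in> W" "s \<ominus> c m \<in> D m" "x \<ominus> s \<in> A k" using x unfolding T_def by blast
    moreover have "x \<in> W" using x unfolding T_def by blast
    ultimately show "\<exists>y. y \<in> T (Suc k) \<and> y \<ominus> x \<in> A k"
      using m subsp_diff_sym[OF A] car by blast
  qed
  then obtain x where xT: "\<And>k. x k \<in> T k" and xA: "\<And>k. x (Suc k) \<ominus> x k \<in> A k" by blast
  have xW: "x k \<in> W" for k using xT unfolding T_def by blast
  obtain y where y: "y \<in> W" "\<And>k. y \<ominus> x k \<in> A k"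
    using complete xW xA unfolding complete_wrt_def by blast
  have "y \<ominus> c k \<in> D k" for k
  proof -
    obtain s where s: "s \<in> W" "s \<ominus> c k \<in> D k" "x k \<ominus> s \<in> A k"
      using xT[of k] unfolding T_def by blast
    have "y \<ominus> s \<in> A k" using subsp_diff_trans[OF A, of y "x k" s] y s xW car by blast
    then show ?thesis using subsp_diff_trans[OF D, of y s "c k"] y s cW car AD by blast
  qed
  then show "\<exists>x\<in>W. \<forall>k. x \<ominus> c k \<in> D k" using y(1) by blast
qed

section \<open>Homogeneous components\<close>

lemma subsp_part: "subsp (part L n)"
  by (rule part_subspace)

lemma part_carrier: "x \<in> part L n \<Longrightarrow> x \<in> carrier L"
  using subspD(2)[OF subsp_part] .

definition decomposition :: "'a \<Rightarrow> (nat \<Rightarrow> 'a) \<Rightarrow> bool" where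
  "decomposition x f \<longleftrightarrow>
     (\<forall>n. f n \<in> part L n) \<and> finite {n. f n \<noteq> \<zero>} \<and> x = (\<Oplus>n\<in>{n. f n \<noteq> \<zero>}. f n)"

definition component :: "nat \<Rightarrow> 'a \<Rightarrow> 'a" where
  "component n x = (THE f. decomposition x f) n"

lemma decompositionI:
  assumes f: "\<And>n. f n \<in> part L n" and A: "finite A" "\<And>n. n \<notin> A \<Longrightarrow> f n = \<zero>"
    and x: "x = (\<Oplus>n\<in>A. f n)"
  shows "decomposition x f"
proof -
  have sub: "{n. f n \<noteq> \<zero>} \<subseteq> A" using A(2) by auto
  have fc: "f n \<in> carrier L" for n using part_carrier[OF f] .
  have "(\<Oplus>n\<in>{n. f n \<noteq> \<zero>}. f n) = (\<Oplus>n\<in>A. f n)"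
    by (rule M.add.finprod_mono_neutral_cong_left[OF A(1) sub]) (simp_all add: Pi_def fc)
  then show ?thesis
    using finite_subset[OF sub A(1)] f x unfolding decomposition_def by simp
qed

lemma decompositionD:
  assumes "decomposition x f" and A: "finite A" "{n. f n \<noteq> \<zero>} \<subseteq> A"
  shows "x = (\<Oplus>n\<in>A. f n)"
proof -
  have f: "f n \<in> carrier L" for n
    by (rule part_carrier[of _ n]) (use assms(1) in \<open>simp add: decomposition_def\<close>)
  have "(\<Oplus>n\<in>{n. f n \<noteq> \<zero>}. f n) = (\<Oplus>n\<in>A. f n)"
    by (rule M.add.finprod_mono_neutral_cong_left[OF A]) (simp_all add: Pi_def f)
  then show ?thesis using assms(1) unfolding decomposition_def by simp
qed

lemma ex1_decomposition: "x \<in> carrier L \<Longrightarrow> \<exists>!f. decomposition x f"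
  unfolding decomposition_def by (rule part_decomposition)

lemma decomposition_component: "x \<in> carrier L \<Longrightarrow> decomposition x (\<lambda>n. component n x)"
  unfolding component_def by (rule theI'[OF ex1_decomposition])

lemma component_eq: "x \<in> carrier L \<Longrightarrow> decomposition x f \<Longrightarrow> component n x = f n"
  using the1_equality[OF ex1_decomposition] unfolding component_def by metis

lemma decomposition_part: "decomposition x f \<Longrightarrow> f n \<in> part L n"
  and decomposition_finite: "decomposition x f \<Longrightarrow> finite {n. f n \<noteq> \<zero>}"
  and decomposition_sum: "decomposition x f \<Longrightarrow> x = (\<Oplus>n\<in>{n. f n \<noteq> \<zero>}. f n)"
  by (simp_all only: decomposition_def)

lemma component_part: "x \<in> carrier L \<Longrightarrow> component n x \<in> part L n"
  using decomposition_part[OF decomposition_component] .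

lemma component_closed: "x \<in> carrier L \<Longrightarrow> component n x \<in> carrier L"
  using component_part part_carrier by blast

lemma component_add:
  assumes x: "x \<in> carrier L" and y: "y \<in> carrier L"
  shows "component n (x \<oplus> y) = component n x \<oplus> component n y"
proof -
  let ?f = "\<lambda>n. component n x" and ?g = "\<lambda>n. component n y"
  let ?A = "{n. ?f n \<noteq> \<zero>} \<union> {n. ?g n \<noteq> \<zero>}"
  have A: "finite ?A"
    using decomposition_finite[OF decomposition_component[OF x]]
      decomposition_finite[OF decomposition_component[OF y]] by simp
  have "x \<oplus> y = (\<Oplus>n\<in>?A. ?f n) \<oplus> (\<Oplus>n\<in>?A. ?g n)"
    using decompositionD[OF decomposition_component[OF x] A]
      decompositionD[OF decomposition_component[OF y] A] by simp
  also have "\<dots> = (\<Oplus>n\<in>?A. ?f n \<oplus> ?g n)"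
    using component_closed x y by (simp add: M.finsum_addf Pi_def)
  finally have "decomposition (x \<oplus> y) (\<lambda>n. ?f n \<oplus> ?g n)"
    using A component_part x y by (intro decompositionI[of _ ?A]) (auto intro: subspD[OF subsp_part])
  then show ?thesis using component_eq x y by simp
qed

lemma component_smult:
  assumes x: "x \<in> carrier L"
  shows "component n (c \<odot> x) = c \<odot> component n x"
proof -
  let ?f = "\<lambda>n. component n x"
  let ?A = "{n. ?f n \<noteq> \<zero>}"
  have A: "finite ?A"
    by (rule decomposition_finite[OF decomposition_component[OF x]])
  have "c \<odot> x = c \<odot> (\<Oplus>n\<in>?A. ?f n)"
    using decompositionD[OF decomposition_component[OF x] A] by simp
  also have "\<dots> = (\<Oplus>n\<in>?A. c \<odot> ?f n)"
    using A component_closed x by (intro finsum_smult_ldistr) auto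
  finally have "decomposition (c \<odot> x) (\<lambda>n. c \<odot> ?f n)"
    using A component_part x
    by (intro decompositionI[of _ ?A]) (auto intro: subspD[OF subsp_part] simp: smult_r_null)
  then show ?thesis using component_eq x by simp
qed

lemma component_diff:
  assumes x: "x \<in> carrier L" and y: "y \<in> carrier L"
  shows "component n (x \<ominus> y) = component n x \<ominus> component n y"
proof -
  have "component n (\<ominus> y) = \<ominus> component n y"
    using component_smult[OF y, of n "- 1"] smult_minus_one y component_closed by simp
  then show ?thesis using x y by (simp add: M.minus_eq component_add)
qed

lemma component_of_part:
  assumes "x \<in> part L m"
  shows "component n x = (if n = m then x else \<zero>)"
proof -
  have "decomposition x (\<lambda>n. if n = m then x else \<zero>)"
    using assms part_carrier[OF assms] subspD(3)[OF subsp_part]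
    by (intro decompositionI[of _ "{m}"]) auto
  then show ?thesis using component_eq part_carrier[OF assms] by simp
qed

lemma finsum_subsp:
  assumes S: "subsp S" and A: "finite A" and f: "\<And>n. n \<in> A \<Longrightarrow> f n \<in> S"
  shows "(\<Oplus>n\<in>A. f n) \<in> S"
  using A f
proof (induction A)
  case (insert a A)
  then have "f \<in> A \<rightarrow> carrier L" "f a \<in> carrier L" using subspD(2)[OF S] by auto
  then show ?case using insert by (auto simp: subspD[OF S])
qed (simp add: subspD[OF S])

lemma mem_by_components:
  assumes "subsp S" "x \<in> carrier L" "\<And>n. component n x \<in> S"
  shows "x \<in> S"
proof -
  have fin: "finite {n. component n x \<noteq> \<zero>}"
    by (rule decomposition_finite[OF decomposition_component[OF assms(2)]])
  have "x = (\<Oplus>n\<in>{n. component n x \<noteq> \<zero>}. component n x)"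
    by (rule decomposition_sum[OF decomposition_component[OF assms(2)]])
  then show ?thesis using finsum_subsp[OF assms(1) fin, of "\<lambda>n. component n x"] assms(3) by simp
qed

lemma component_eventually_zero:
  assumes "x \<in> carrier L"
  shows "\<exists>N. \<forall>n\<ge>N. component n x = \<zero>"
proof -
  have fin: "finite {n. component n x \<noteq> \<zero>}"
    by (rule decomposition_finite[OF decomposition_component[OF assms]])
  then obtain N where "\<forall>n\<in>{n. component n x \<noteq> \<zero>}. n < N"
    using finite_nat_set_iff_bounded by blast
  then show ?thesis by (metis (mono_tags, lifting) mem_Collect_eq not_less)
qed

definition homogeneous :: "'a set" where
  "homogeneous = (\<Union>n. part L n)"

definition graded :: "'a set \<Rightarrow> bool" where
  "graded S \<longleftrightarrow> subsp S \<and> (\<forall>x\<in>S. \<forall>n. component n x \<in> S)"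

lemma homogeneous_carrier: "homogeneous \<subseteq> carrier L"
  using part_carrier unfolding homogeneous_def by blast

text \<open>
  The span of homogeneous elements is graded. This is the tool for restricting spanning sets to one
  degree.
\<close>

lemma component_span:
  assumes T: "T \<subseteq> homogeneous" and x: "x \<in> sp T"
  shows "component n x \<in> sp (T \<inter> part L n)"
proof -
  have Tc: "T \<subseteq> carrier L" "T \<inter> part L n \<subseteq> carrier L" using T homogeneous_carrier by auto
  note sub = sp_subspace[OF Tc(2)]
  let ?S = "{x \<in> carrier L. component n x \<in> sp (T \<inter> part L n)}"
  have zero: "component n \<zero> = \<zero>"
    using component_of_part[OF subspD(3)[OF subsp_part]] by simp
  have "subsp ?S"
    by (rule subspI) (auto simp: component_add component_smult zero subspD[OF sub])
  moreover have "T \<subseteq> ?S"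
  proof
    fix t assume t: "t \<in> T"
    then obtain m where m: "t \<in> part L m" using T unfolding homogeneous_def by blast
    show "t \<in> ?S"
      using component_of_part[OF m, of n] t m Tc sp_superset[OF Tc(2)] subspD(3)[OF sub] by auto
  qed
  ultimately show ?thesis using sp_least[of T ?S] x by blast
qed

lemma part_span:
  assumes "T \<subseteq> homogeneous" "x \<in> sp T" "x \<in> part L n"
  shows "x \<in> sp (T \<inter> part L n)"
  using component_span[OF assms(1,2), of n] component_of_part[OF assms(3), of n] by simp

lemma gradedD:
  assumes "graded S"
  shows "subsp S" "x \<in> S \<Longrightarrow> component n x \<in> S"
  using assms unfolding graded_def by auto

lemma graded_span:
  assumes "T \<subseteq> homogeneous"
  shows "graded (sp T)"
  unfolding graded_def
proof (intro conjI ballI allI)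
  have c: "T \<subseteq> carrier L" using assms homogeneous_carrier by blast
  show "subsp (sp T)" by (rule sp_subspace[OF c])
  fix x n assume "x \<in> sp T"
  then show "component n x \<in> sp T"
    using component_span[OF assms, of x n] sp_mono[of "T \<inter> part L n" T] c by blast
qed

lemma graded_eq_span:
  assumes "graded S"
  shows "S = sp (S \<inter> homogeneous)"
proof
  note S = gradedD(1)[OF assms]
  show "sp (S \<inter> homogeneous) \<subseteq> S" by (intro sp_least S) auto
  show "S \<subseteq> sp (S \<inter> homogeneous)"
  proof
    fix x assume x: "x \<in> S"
    have "component n x \<in> sp (S \<inter> homogeneous)" for n
      using gradedD(2)[OF assms x] component_part[OF subspD(2)[OF S x]]
        sp_superset[of "S \<inter> homogeneous"] homogeneous_carrier
      unfolding homogeneous_def by blast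
    then show "x \<in> sp (S \<inter> homogeneous)"
      using subspD(2)[OF S x] homogeneous_carrier
      by (rule_tac mem_by_components[OF sp_subspace]) auto
  qed
qed

lemma graded_iff: "subsp S \<Longrightarrow> graded S \<longleftrightarrow> S = sp (\<Union>n. S \<inter> part L n)"
proof -
  have eq: "(\<Union>n. S \<inter> part L n) = S \<inter> homogeneous" unfolding homogeneous_def by blast
  show ?thesis
    using graded_eq_span[of S] graded_span[of "S \<inter> homogeneous"] unfolding eq
    by (metis inf_le2)
qed

lemma graded_carrier: "graded (carrier L)"
  unfolding graded_def using subsp_carrier component_closed by blast

lemma graded_sum:
  assumes "graded S" "graded T"
  shows "graded (S <+> T)"
  unfolding graded_def
proof (intro conjI ballI allI)
  note sub = gradedD(1)[OF assms(1)] gradedD(1)[OF assms(2)]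
  show "subsp (S <+> T)" by (rule subsp_sum[OF sub])
  fix x n assume "x \<in> S <+> T"
  then obtain s where s: "x \<in> carrier L" "s \<in> S" "x \<ominus> s \<in> T" using mem_sum[OF sub] by blast
  then have "component n x \<ominus> component n s \<in> T"
    using component_diff[of x s n] subspD(2)[OF sub(1)] gradedD(2)[OF assms(2) s(3), of n] by simp
  then show "component n x \<in> S <+> T"
    using s gradedD(2)[OF assms(1) s(2)] component_closed by (intro sumI[OF sub]) auto
qed

lemma bracket_zero:
  assumes "x \<in> carrier L"
  shows "bracket L \<zero> x = \<zero>" "bracket L x \<zero> = \<zero>"
  using bracket_smult_left[of \<zero> x 0] bracket_smult_right[of x \<zero> 0] assms
    smult_l_null[of "bracket L \<zero> x"] smult_l_null[of "bracket L x \<zero>"] smult_l_null[of \<zero>]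
    bracket_closed by simp_all

lemma bracket_diff:
  assumes "x \<in> carrier L" "y \<in> carrier L" "z \<in> carrier L"
  shows "bracket L (x \<ominus> y) z = bracket L x z \<ominus> bracket L y z"
    "bracket L z (x \<ominus> y) = bracket L z x \<ominus> bracket L z y"
proof -
  have "bracket L (\<ominus> y) z = \<ominus> bracket L y z" "bracket L z (\<ominus> y) = \<ominus> bracket L z y"
    using bracket_smult_left[of y z "- 1"] bracket_smult_right[of z y "- 1"] assms bracket_closed
      smult_minus_one by simp_all
  then show "bracket L (x \<ominus> y) z = bracket L x z \<ominus> bracket L y z"
    "bracket L z (x \<ominus> y) = bracket L z x \<ominus> bracket L z y"
    using assms by (simp_all add: M.minus_eq bracket_add_left bracket_add_right)
qed

lemma subsp_bracket_preimage:
  assumes "subsp U" "v \<in> carrier L"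
  shows "subsp {x \<in> carrier L. bracket L v x \<in> U}" "subsp {x \<in> carrier L. bracket L x v \<in> U}"
  using assms
  by (auto intro!: subspI simp: bracket_add_left bracket_add_right bracket_smult_left
      bracket_smult_right bracket_zero subspD)

text \<open>
  Bilinearity reduces a claim about brackets of two spans to the generators.
\<close>

lemma bracket_span:
  assumes U: "subsp U" and c: "S \<subseteq> carrier L" "T \<subseteq> carrier L"
    and gen: "\<And>s t. s \<in> S \<Longrightarrow> t \<in> T \<Longrightarrow> bracket L s t \<in> U"
    and x: "x \<in> sp S" and y: "y \<in> sp T"
  shows "bracket L x y \<in> U"
proof -
  have 1: "bracket L s y \<in> U" if s: "s \<in> S" for s
  proof -
    have "sp T \<subseteq> {x \<in> carrier L. bracket L s x \<in> U}"
      using c s gen by (intro sp_least subsp_bracket_preimage U) auto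
    then show ?thesis using y by blast
  qed
  have y': "y \<in> carrier L" using subspD(2)[OF sp_subspace[OF c(2)] y] .
  have "sp S \<subseteq> {x \<in> carrier L. bracket L x y \<in> U}"
    using c 1 y' by (intro sp_least subsp_bracket_preimage U) auto
  then show ?thesis using x by blast
qed

section \<open>Powers of a graded Lie algebra\<close>

text \<open>
  The power \<open>L\<^bsup>k+1\<^esup>\<close> in the form \<open>[L, [L, \<dots> [L, L]]]\<close>. The homogeneity of both factors
  makes it graded by construction and allows the use of the signed identities, which hold for
  homogeneous elements.
\<close>

primrec left_power :: "nat \<Rightarrow> 'a set" where
  "left_power 0 = carrier L"
| "left_power (Suc k) =
     sp {bracket L x y | x y. x \<in> homogeneous \<and> y \<in> left_power k \<inter> homogeneous}"

declare left_power.simps(2) [simp del]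

lemma homogeneous_bracket:
  "x \<in> homogeneous \<Longrightarrow> y \<in> homogeneous \<Longrightarrow> bracket L x y \<in> homogeneous"
  using bracket_part unfolding homogeneous_def by blast

lemma graded_left_power: "graded (left_power k)"
  by (cases k) (auto simp: left_power.simps(2) graded_carrier homogeneous_bracket intro!: graded_span)

lemmas subsp_left_power = gradedD(1)[OF graded_left_power]

lemma left_power_Suc_subset: "left_power (Suc k) \<subseteq> left_power k"
proof (induction k)
  case 0
  then show ?case using subspD(1)[OF subsp_left_power[of 1]] by simp
next
  case (Suc k)
  have "{bracket L x y | x y. x \<in> homogeneous \<and> y \<in> left_power k \<inter> homogeneous} \<subseteq> carrier L"
    using homogeneous_bracket homogeneous_carrier by blast
  then show ?case
    unfolding left_power.simps(2)[of "Suc k"] unfolding left_power.simps(2)[of k]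
    using Suc unfolding left_power.simps(2)[of k]
    by (intro sp_mono) blast+
qed

lemma left_power_bracket_left:
  assumes "x \<in> carrier L" "y \<in> left_power k"
  shows "bracket L x y \<in> left_power (Suc k)"
proof (rule bracket_span[OF subsp_left_power])
  show "x \<in> sp homogeneous"
    using graded_eq_span[OF graded_carrier] assms(1) homogeneous_carrier by (simp add: Int_absorb1)
  show "y \<in> sp (left_power k \<inter> homogeneous)"
    using graded_eq_span[OF graded_left_power] assms(2) by blast
  fix s t assume "s \<in> homogeneous" "t \<in> left_power k \<inter> homogeneous"
  then show "bracket L s t \<in> left_power (Suc k)"
    using sp_superset[of "{bracket L x y | x y. x \<in> homogeneous \<and> y \<in> left_power k \<inter> homogeneous}"]
      homogeneous_bracket homogeneous_carrier by (auto simp: left_power.simps(2))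
qed (use homogeneous_carrier in auto)

text \<open>
  The Jacobi identity writes \<open>[[a, b], z]\<close> as a combination of \<open>[a, [b, z]]\<close> and \<open>[b, [a, z]]\<close>, in
  which \<open>a\<close> stands outside or inside and the left factor \<open>b\<close> is shorter.
\<close>

lemma left_power_bracket:
  assumes "x \<in> left_power i" "y \<in> left_power j"
  shows "bracket L x y \<in> left_power (Suc (i + j))"
  using assms
proof (induction i arbitrary: j x y)
  case 0
  then show ?case using left_power_bracket_left by simp
next
  case (Suc i)
  let ?G = "{bracket L x y | x y. x \<in> homogeneous \<and> y \<in> left_power i \<inter> homogeneous}"
  show ?case
  proof (rule bracket_span[OF subsp_left_power])
    show "x \<in> sp ?G" using Suc.prems(1) by (simp add: left_power.simps(2))
    show "y \<in> sp (left_power j \<inter> homogeneous)"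
      using graded_eq_span[OF graded_left_power] Suc.prems(2) by blast
    show "?G \<subseteq> carrier L" using homogeneous_bracket homogeneous_carrier by blast
    show "left_power j \<inter> homogeneous \<subseteq> carrier L" using homogeneous_carrier by blast
    fix s z assume "s \<in> ?G" and z: "z \<in> left_power j \<inter> homogeneous"
    then obtain a b where s: "s = bracket L a b" "a \<in> homogeneous" "b \<in> left_power i" "b \<in> homogeneous"
      by blast
    obtain m n p where mnp: "a \<in> part L m" "b \<in> part L n" "z \<in> part L p"
      using s z unfolding homogeneous_def by blast
    have c: "a \<in> carrier L" "b \<in> carrier L" "z \<in> carrier L" using mnp part_carrier by auto
    let ?q = "(- 1) ^ (m * n) \<odot> bracket L b (bracket L a z)"
    have jac: "bracket L a (bracket L b z) = bracket L s z \<oplus> ?q"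
      using bracket_jacobi[OF mnp] s(1) by simp
    have "bracket L a (bracket L b z) \<in> left_power (Suc (Suc (i + j)))"
      using left_power_bracket_left[OF c(1) Suc.IH[OF s(3)]] z by simp
    moreover have "?q \<in> left_power (Suc (Suc (i + j)))"
      using subspD(5)[OF subsp_left_power Suc.IH[OF s(3) left_power_bracket_left[OF c(1)]]] z by simp
    moreover have "bracket L s z \<in> carrier L" "?q \<in> carrier L"
      using c s(1) bracket_closed by simp_all
    then have "bracket L s z = bracket L a (bracket L b z) \<ominus> ?q"
      unfolding jac by (simp add: diff_arith)
    ultimately show "bracket L s z \<in> left_power (Suc (Suc i + j))"
      using subsp_diff[OF subsp_left_power] by simp
  qed
qed

lemma iterated_bracket_pos: "iterated_bracket L k x \<Longrightarrow> 1 \<le> k \<and> x \<in> carrier L"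
  by (induction rule: iterated_bracket.induct) (auto simp: bracket_closed)

lemma iterated_bracket_left_power:
  "iterated_bracket L k x \<Longrightarrow> x \<in> left_power (k - 1)"
proof (induction rule: iterated_bracket.induct)
  case (bracket i x j y)
  then have "Suc (i - 1 + (j - 1)) = i + j - 1"
    using iterated_bracket_pos[of i x] iterated_bracket_pos[of j y] by linarith
  then show ?case using left_power_bracket[OF bracket.IH] by metis
qed simp

lemma subsp_lie_power: "subsp (lie_power L k)"
  unfolding lie_power_def using iterated_bracket_pos by (intro sp_subspace) blast

lemma iterated_bracket_lie_power: "iterated_bracket L k x \<Longrightarrow> x \<in> lie_power L k"
  unfolding lie_power_def
  using iterated_bracket_pos sp_superset[of "{x. iterated_bracket L k x}"] by blast

text \<open>
  Arbitrary placement of brackets gives nothing beyond the brackets nested to the right.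
\<close>

lemma lie_power_Suc_eq: "lie_power L (Suc k) = left_power k"
proof
  show "lie_power L (Suc k) \<subseteq> left_power k"
    unfolding lie_power_def using iterated_bracket_left_power
    by (intro sp_least subsp_left_power) fastforce
  show "left_power k \<subseteq> lie_power L (Suc k)"
  proof (induction k)
    case 0
    show ?case using iterated_bracket.single iterated_bracket_lie_power by fastforce
  next
    case (Suc k)
    have "bracket L x y \<in> lie_power L (Suc (Suc k))" if "x \<in> carrier L" "y \<in> lie_power L (Suc k)" for x y
    proof (rule bracket_span[OF subsp_lie_power])
      show "x \<in> sp (carrier L)" using that sp_eq[OF subsp_carrier] by simp
      show "y \<in> sp {x. iterated_bracket L (Suc k) x}" using that unfolding lie_power_def by simp
      fix s t assume "s \<in> carrier L" "t \<in> {x. iterated_bracket L (Suc k) x}"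
      then show "bracket L s t \<in> lie_power L (Suc (Suc k))"
        using iterated_bracket.bracket[OF iterated_bracket.single] iterated_bracket_lie_power
        by fastforce
    qed (use iterated_bracket_pos in auto)
    then show ?case
      using Suc homogeneous_carrier unfolding left_power.simps(2)
      by (intro sp_least subsp_lie_power) auto
  qed
qed

lemma left_power_antimono: "j \<le> k \<Longrightarrow> left_power k \<subseteq> left_power j"
  using lift_Suc_antimono_le[of left_power] left_power_Suc_subset by blast

lemma part_span_Un:
  assumes S: "graded S" and T: "T \<subseteq> part L n" and x: "x \<in> part L n" "x \<in> sp (T \<union> S)"
  shows "x \<in> sp (T \<union> (S \<inter> part L n))"
proof -
  let ?T = "T \<union> (S \<inter> homogeneous)"
  have hom: "?T \<subseteq> homogeneous" using T unfolding homogeneous_def by blast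
  then have c: "?T \<subseteq> carrier L" using homogeneous_carrier by blast
  have "S \<subseteq> sp ?T"
    using graded_eq_span[OF S] sp_mono[of "S \<inter> homogeneous" ?T] c by blast
  then have "sp (T \<union> S) \<subseteq> sp ?T"
    using sp_superset[OF c] by (intro sp_least sp_subspace c) auto
  then have "x \<in> sp (?T \<inter> part L n)" using part_span[OF hom _ x(1)] x(2) by blast
  moreover have "?T \<inter> part L n \<subseteq> T \<union> (S \<inter> part L n)" by blast
  moreover have "T \<union> (S \<inter> part L n) \<subseteq> carrier L" using T part_carrier by blast
  ultimately show ?thesis using sp_mono by blast
qed

lemma subsp_left_power_part: "subsp (left_power k \<inter> part L n)"
  by (intro subsp_Int subsp_left_power subsp_part)

end

section \<open>Finite codimension of the powers\<close>

text \<open>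
  The set \<open>V n\<close> lifts a finite spanning set of the degree \<open>n\<close> part of \<open>L / L\<^sup>2\<close>; the index \<open>1\<close> of
  \<open>left_power\<close> stands for \<open>L\<^sup>2\<close>.
\<close>

locale degreewise_generated = lie_algebra +
  fixes V :: "nat \<Rightarrow> 'a set"
  assumes V_finite: "finite (V n)" and V_part: "V n \<subseteq> part L n"
    and V_generates: "part L n \<subseteq> sp (V n \<union> left_power 1)"
begin

text \<open>
  These brackets span the finite sum \<open>T\<close> of the spaces \<open>[v, L\<^bsup>k+1\<^esup>]\<close> in degree \<open>n\<close>. Only
  finitely many \<open>v\<close> occur, as a generator of degree above \<open>n\<close> cannot contribute.
\<close>

definition generator_brackets :: "nat \<Rightarrow> nat \<Rightarrow> 'a set" where
  "generator_brackets k n = (\<Union>i\<in>{..n}. \<Union>v\<in>V i. bracket L v ` (left_power k \<inter> part L (n - i)))"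

lemma generator_bracketsI:
  assumes "v \<in> V i" "y \<in> left_power k" "y \<in> part L j" "i + j = n"
  shows "bracket L v y \<in> generator_brackets k n"
proof -
  have "i \<in> {..n}" "j = n - i" using assms(4) by auto
  then show ?thesis using assms(1-3) unfolding generator_brackets_def by blast
qed

lemma generator_bracketsE:
  assumes "x \<in> generator_brackets k n"
  obtains v i y j where "v \<in> V i" "y \<in> left_power k" "y \<in> part L j" "i + j = n" "x = bracket L v y"
  using assms unfolding generator_brackets_def by force

lemma generator_brackets_subset: "generator_brackets k n \<subseteq> left_power (Suc k) \<inter> part L n"
proof
  fix x assume "x \<in> generator_brackets k n"
  then obtain v i y j where x: "v \<in> V i" "y \<in> left_power k" "y \<in> part L j" "i + j = n" "x = bracket L v y"
    by (rule generator_bracketsE)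
  then have "v \<in> part L i" using V_part by blast
  then show "x \<in> left_power (Suc k) \<inter> part L n"
    using x left_power_bracket_left part_carrier bracket_part by blast
qed

lemma generator_brackets_carrier: "generator_brackets k n \<subseteq> carrier L"
  using generator_brackets_subset part_carrier by blast

text \<open>
  In a bracket \<open>[x, y]\<close> write \<open>x\<close> as a combination of the generators plus an element of \<open>L\<^sup>2\<close>. The
  first part gives generator brackets, the second gains one more factor.
\<close>

lemma left_power_step:
  "left_power (Suc k) \<inter> part L n \<subseteq> sp (generator_brackets k n \<union> (left_power (Suc (Suc k)) \<inter> part L n))"
proof
  let ?G = "{bracket L x y | x y. x \<in> homogeneous \<and> y \<in> left_power k \<inter> homogeneous}"
  let ?R = "generator_brackets k n \<union> (left_power (Suc (Suc k)) \<inter> part L n)"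
  have R: "?R \<subseteq> carrier L" using generator_brackets_carrier part_carrier by blast
  note sub = sp_subspace[OF R]
  fix z assume z: "z \<in> left_power (Suc k) \<inter> part L n"
  have hom: "?G \<subseteq> homogeneous" using homogeneous_bracket by blast
  have "z \<in> sp ?G" using z by (simp add: left_power.simps(2))
  then have "z \<in> sp (?G \<inter> part L n)" using part_span[OF hom] z by blast
  moreover have "sp (?G \<inter> part L n) \<subseteq> sp ?R"
  proof (intro sp_least sub subsetI)
    fix w assume w: "w \<in> ?G \<inter> part L n"
    then obtain x y where xy: "x \<in> homogeneous" "y \<in> left_power k" "y \<in> homogeneous" "w = bracket L x y"
      by blast
    then obtain i j where ij: "x \<in> part L i" "y \<in> part L j" unfolding homogeneous_def by blast
    have wij: "w \<in> part L (i + j)" using bracket_part[OF ij] xy(4) by simp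
    show "w \<in> sp ?R"
    proof (cases "i + j = n")
      case False
      then have "w = \<zero>"
        using component_of_part[OF wij, of n] component_of_part[of w n n] w by auto
      then show ?thesis using subspD(3)[OF sub] by simp
    next
      case True
      have Sc: "V i \<union> (left_power 1 \<inter> part L i) \<subseteq> carrier L" "{y} \<subseteq> carrier L"
        using V_part part_carrier ij by blast+
      show ?thesis unfolding xy(4)
      proof (rule bracket_span[OF sub Sc])
        show "x \<in> sp (V i \<union> (left_power 1 \<inter> part L i))"
          using part_span_Un[OF graded_left_power V_part ij(1)] V_generates ij(1) by blast
        show "y \<in> sp {y}" using sp_superset[OF Sc(2)] by blast
        fix s t assume s: "s \<in> V i \<union> (left_power 1 \<inter> part L i)" and t: "t \<in> {y}"
        have "bracket L s y \<in> ?R"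
        proof (cases "s \<in> V i")
          case True
          then show ?thesis using generator_bracketsI[OF True xy(2) ij(2) \<open>i + j = n\<close>] by blast
        next
          case False
          then have "bracket L s y \<in> left_power (Suc (Suc k))" "bracket L s y \<in> part L n"
            using s left_power_bracket[of s 1 y k] xy(2) bracket_part[of s i y j] ij(2) \<open>i + j = n\<close>
            by auto
          then show ?thesis by blast
        qed
        then show "bracket L s t \<in> sp ?R" using t sp_superset[OF R] by blast
      qed
    qed
  qed
  ultimately show "z \<in> sp ?R" by blast
qed

lemma left_power_approx:
  "left_power (Suc k) \<inter> part L n \<subseteq> sp (generator_brackets k n \<union> (left_power (Suc k + r) \<inter> part L n))"
proof (induction r)
  case 0
  have "generator_brackets k n \<union> (left_power (Suc k + 0) \<inter> part L n) \<subseteq> carrier L"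
    using generator_brackets_carrier part_carrier by blast
  from sp_superset[OF this] show ?case by simp
next
  case (Suc r)
  let ?R = "generator_brackets k n \<union> (left_power (Suc k + Suc r) \<inter> part L n)"
  have R: "?R \<subseteq> carrier L" using generator_brackets_carrier part_carrier by blast
  have "generator_brackets (k + r) n \<subseteq> generator_brackets k n"
    unfolding generator_brackets_def
    by (intro UN_mono image_mono Int_mono subset_refl left_power_antimono) simp
  then have "generator_brackets (k + r) n \<union> (left_power (Suc (Suc (k + r))) \<inter> part L n) \<subseteq> ?R"
    by auto
  from subset_trans[OF left_power_step sp_mono[OF this R]]
  have "left_power (Suc k + r) \<inter> part L n \<subseteq> sp ?R" by simp
  then have "generator_brackets k n \<union> (left_power (Suc k + r) \<inter> part L n) \<subseteq> sp ?R"
    using sp_superset[OF R] by blast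
  then show ?case using Suc sp_least[OF _ sp_subspace[OF R]] by blast
qed

text \<open>
  If finitely many elements span \<open>L\<^bsup>k+1\<^esup>\<close> modulo \<open>L\<^bsup>k+2\<^esup>\<close> in each degree up to \<open>n\<close>, then
  their brackets with the generators span \<open>L\<^bsup>k+2\<^esup>\<close> modulo \<open>L\<^bsup>k+3\<^esup>\<close> in degree \<open>n\<close>.
\<close>

lemma finite_over_left_power_Suc:
  "finite_over (left_power (Suc k) \<inter> part L n) (left_power k \<inter> part L n)"
proof (induction k arbitrary: n)
  case 0
  have "part L n \<subseteq> sp ((left_power 1 \<inter> part L n) \<union> V n)"
    using part_span_Un[OF graded_left_power V_part] V_generates by (simp add: Un_commute) blast
  moreover have "V n \<subseteq> carrier L" using V_part part_carrier by blast
  ultimately show ?case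
    using V_finite unfolding finite_over_def by (intro exI[of _ "V n"]) auto
next
  case (Suc k)
  obtain F where F: "\<And>j. finite (F j)" "\<And>j. F j \<subseteq> carrier L"
      "\<And>j. left_power k \<inter> part L j \<subseteq> sp ((left_power (Suc k) \<inter> part L j) \<union> F j)"
    using Suc.IH unfolding finite_over_def by metis
  let ?X = "left_power (Suc (Suc k)) \<inter> part L n"
  let ?E = "\<Union>i\<in>{..n}. \<Union>v\<in>V i. bracket L v ` F (n - i)"
  have E: "finite ?E" "?E \<subseteq> carrier L"
    using F V_finite V_part part_carrier bracket_closed by (blast+)
  have c: "?X \<union> ?E \<subseteq> carrier L" using E(2) part_carrier by blast
  have "generator_brackets k n \<subseteq> sp (?X \<union> ?E)"
  proof
    fix x assume "x \<in> generator_brackets k n"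
    then obtain v i y j where x: "v \<in> V i" "y \<in> left_power k" "y \<in> part L j" "i + j = n" "x = bracket L v y"
      by (rule generator_bracketsE)
    have v: "v \<in> part L i" "v \<in> carrier L" using x(1) V_part part_carrier by blast+
    show "x \<in> sp (?X \<union> ?E)" unfolding x(5)
    proof (rule bracket_span[OF sp_subspace[OF c]])
      show "v \<in> sp {v}" using sp_superset[of "{v}"] v by blast
      show "y \<in> sp ((left_power (Suc k) \<inter> part L j) \<union> F j)" using F(3) x by blast
      show "(left_power (Suc k) \<inter> part L j) \<union> F j \<subseteq> carrier L" using F(2) part_carrier by blast
      fix s t assume "s \<in> {v}" and t: "t \<in> (left_power (Suc k) \<inter> part L j) \<union> F j"
      then have s: "s = v" by simp
      have "bracket L v t \<in> ?X \<union> ?E"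
      proof (cases "t \<in> F j")
        case True
        have "i \<in> {..n}" "j = n - i" using x(4) by auto
        then show ?thesis using True x(1) by blast
      next
        case False
        then show ?thesis using t left_power_bracket_left[OF v(2)] bracket_part[OF v(1)] x(4) by blast
      qed
      then show "bracket L s t \<in> sp (?X \<union> ?E)" unfolding s using sp_superset[OF c] by blast
    qed (use v in auto)
  qed
  then have "sp (generator_brackets k n \<union> ?X) \<subseteq> sp (?X \<union> ?E)"
    using sp_superset[OF c] by (intro sp_least sp_subspace c) auto
  then have "left_power (Suc k) \<inter> part L n \<subseteq> sp (?X \<union> ?E)" using left_power_step by blast
  then show ?case using E unfolding finite_over_def by blast
qed

lemma finite_over_left_power: "finite_over (left_power k \<inter> part L n) (part L n)"
proof (induction k)
  case 0
  then show ?case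
    using finite_over_refl[OF subspD(1)[OF subsp_part]] subspD(1)[OF subsp_part[of n]]
    by (simp add: Int_absorb1)
next
  case (Suc k)
  then show ?case
    using finite_over_trans[OF _ finite_over_left_power_Suc] subspD(1)[OF subsp_left_power_part]
    by blast
qed

end

section \<open>Closed subspaces for a complete filtration\<close>

locale complete_filtration = lie_algebra +
  fixes B :: "nat \<Rightarrow> 'a set"
  assumes B_subsp: "subsp (B k)"
    and B_bracket: "x \<in> carrier L \<Longrightarrow> y \<in> B k \<Longrightarrow> bracket L x y \<in> B k"
    and B_dec: "B (Suc k) \<subseteq> B k"
    and B_Inter: "(\<Inter>k. B k) = {\<zero>}"
    and B_finite: "finite_over (B k \<inter> part L n) (part L n)"
    and B_complete: "complete_wrt (part L n) (\<lambda>k. B k \<inter> part L n)"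
begin

text \<open>
  The intersection of the spaces \<open>C + B k\<close> is the closure of \<open>C\<close>.
\<close>

definition closed_in :: "nat \<Rightarrow> 'a set \<Rightarrow> bool" where
  "closed_in n C \<longleftrightarrow>
     subsp C \<and> C \<subseteq> part L n \<and> (\<forall>x\<in>part L n. (\<forall>k. x \<in> C <+> B k) \<longrightarrow> x \<in> C)"

lemma closed_inD:
  assumes "closed_in n C"
  shows "subsp C" "C \<subseteq> part L n" "x \<in> part L n \<Longrightarrow> (\<And>k. x \<in> C <+> B k) \<Longrightarrow> x \<in> C"
  using assms unfolding closed_in_def by auto

lemma closed_in_part: "closed_in n (part L n)"
  unfolding closed_in_def using subsp_part by blast

lemma eq_of_congruent:
  assumes "x \<in> carrier L" "y \<in> carrier L" "\<And>k. x \<ominus> y \<in> B k"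
  shows "x = y"
proof -
  have "x \<ominus> y = \<zero>" using B_Inter assms(3) by blast
  then show ?thesis using assms(1,2) by (metis M.add.inv_solve_right' M.l_zero M.minus_eq M.zero_closed)
qed

lemma closed_in_zero: "closed_in n {\<zero>}"
  unfolding closed_in_def
proof (intro conjI ballI impI)
  fix x assume x: "x \<in> part L n" "\<forall>k. x \<in> {\<zero>} <+> B k"
  then have "x \<ominus> \<zero> \<in> B k" for k using mem_sum[OF subsp_zero B_subsp] by blast
  then show "x \<in> {\<zero>}" using eq_of_congruent[of x \<zero>] part_carrier[OF x(1)] by blast
qed (use subsp_zero subspD(3)[OF subsp_part] in auto)

lemma complete_coarser_part:
  assumes D: "\<And>k. subsp (D k)" "\<And>k. B k \<inter> part L n \<subseteq> D k" "\<And>k. D k \<subseteq> part L n" "\<And>k. D (Suc k) \<subseteq> D k"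
    and c: "\<And>k. c k \<in> part L n" "\<And>k. c (Suc k) \<ominus> c k \<in> D k"
  obtains x where "x \<in> part L n" "\<And>k. x \<ominus> c k \<in> D k"
proof -
  have "complete_wrt (part L n) D"
    by (rule complete_coarser[of _ "\<lambda>k. B k \<inter> part L n"])
      (use D B_finite B_complete in \<open>auto intro: subsp_part subsp_Int B_subsp\<close>)
  then show thesis using c that unfolding complete_wrt_def by blast
qed

text \<open>
  Let \<open>y\<close> be in the closure of \<open>C + D\<close>. The elements \<open>c\<close> of \<open>C\<close> with \<open>y - c\<close> in \<open>D + B k\<close> form a
  decreasing sequence of affine spaces with directions \<open>E k\<close>, up to \<open>B k\<close>. Completeness for \<open>E\<close> gives a
  point \<open>x\<close> with \<open>x\<close> in the closure of \<open>C\<close> and \<open>y - x\<close> in the closure of \<open>D\<close>.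
\<close>

lemma closed_in_sum:
  assumes C: "closed_in n C" and D: "closed_in n D"
  shows "closed_in n (C <+> D)"
  unfolding closed_in_def
proof (intro conjI ballI impI)
  note sC = closed_inD(1)[OF C] and sD = closed_inD(1)[OF D]
  note sub = subsp_sum[OF sC sD]
  show "subsp (C <+> D)" by (rule sub)
  show "C <+> D \<subseteq> part L n"
    by (rule sum_least[OF sC sD subsp_part]) (use C D closed_inD in auto)
  fix y assume y: "y \<in> part L n" "\<forall>k. y \<in> C <+> D <+> B k"
  have yc: "y \<in> carrier L" using y part_carrier by blast
  define E where "E k = (C <+> B k) \<inter> (D <+> B k) \<inter> part L n" for k
  have sB: "subsp (C <+> B k)" "subsp (D <+> B k)" for k
    using subsp_sum[OF sC B_subsp] subsp_sum[OF sD B_subsp] .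
  have "\<exists>c\<in>C. y \<ominus> c \<in> D <+> B k" for k
  proof -
    obtain s where s: "s \<in> C <+> D" "y \<ominus> s \<in> B k" using y(2) mem_sum[OF sub B_subsp] by blast
    then obtain c where c: "c \<in> C" "s \<ominus> c \<in> D" "s \<in> carrier L" using mem_sum[OF sC sD] by blast
    have cc: "c \<in> carrier L" using subspD(2)[OF sC c(1)] .
    have "(y \<ominus> c) \<ominus> (s \<ominus> c) \<in> B k" using diff_diff(2)[of y s c] yc c(3) cc s(2) by simp
    then have "y \<ominus> c \<in> D <+> B k"
      using yc cc c(2) by (intro sumI[OF sD B_subsp]) auto
    then show ?thesis using c(1) by blast
  qed
  then obtain c where c: "\<And>k. c k \<in> C" "\<And>k. y \<ominus> c k \<in> D <+> B k" by metis
  have cc: "c k \<in> part L n" "c k \<in> carrier L" for k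
    using c(1) closed_inD(2)[OF C] part_carrier by blast+
  have mono: "D <+> B (Suc k) \<subseteq> D <+> B k" "C <+> B (Suc k) \<subseteq> C <+> B k" for k
    by (rule sum_mono[OF subset_refl B_dec])+
  obtain x where x: "x \<in> part L n" "\<And>k. x \<ominus> c k \<in> E k"
  proof (rule complete_coarser_part[of E n c])
    show "subsp (E k)" for k unfolding E_def by (intro subsp_Int sB subsp_part)
    show "B k \<inter> part L n \<subseteq> E k" for k
      unfolding E_def using sum_upper(2)[OF sC B_subsp] sum_upper(2)[OF sD B_subsp] by blast
    show "E k \<subseteq> part L n" "E (Suc k) \<subseteq> E k" for k unfolding E_def using mono by blast+
    show "c (Suc k) \<ominus> c k \<in> E k" for k
    proof -
      have "c (Suc k) \<ominus> c k \<in> C" by (rule subsp_diff[OF sC c(1) c(1)])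
      moreover have "(y \<ominus> c k) \<ominus> (y \<ominus> c (Suc k)) \<in> D <+> B k"
        using c(2)[of "Suc k"] mono by (intro subsp_diff[OF sB(2) c(2)]) blast
      then have "c (Suc k) \<ominus> c k \<in> D <+> B k"
        using diff_diff(3)[of y "c k" "c (Suc k)"] yc cc by simp
      ultimately show ?thesis
        unfolding E_def using sum_upper(1)[OF sC B_subsp] closed_inD(2)[OF C] by blast
    qed
  qed (use cc in auto)
  have xc: "x \<in> carrier L" using x part_carrier by blast
  have "x \<in> C <+> B k" for k
    using x(2)[of k] c(1)[of k] sum_upper(1)[OF sC B_subsp] xc unfolding E_def
    by (intro subsp_diff_mem[OF sB(1), of x "c k"]) auto
  then have "x \<in> C" using closed_inD(3)[OF C x(1)] by blast
  have "y \<ominus> x \<in> D <+> B k" for k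
    using subsp_diff_trans[OF sB(2), of y "c k" x k] c(2) x(2)[of k] subsp_diff_sym[OF sB(2)] yc xc cc
    unfolding E_def by blast
  moreover have "y \<ominus> x \<in> part L n" using subsp_diff[OF subsp_part] y x by blast
  ultimately have "y \<ominus> x \<in> D" using closed_inD(3)[OF D] by blast
  then show "y \<in> C <+> D" using \<open>x \<in> C\<close> by (intro sumI[OF sC sD yc]) auto
qed

text \<open>
  The same argument for the equation \<open>[v, x] = y\<close>: the approximate solutions \<open>x\<close> modulo \<open>B k\<close> form affine
  spaces with directions \<open>E k\<close>, and completeness for \<open>E\<close> turns them into an exact solution in \<open>C\<close>.
\<close>

lemma closed_in_bracket_image:
  assumes v: "v \<in> part L i" and C: "closed_in j C"
  shows "closed_in (i + j) (bracket L v ` C)"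
  unfolding closed_in_def
proof (intro conjI ballI impI)
  note sC = closed_inD(1)[OF C]
  have vc: "v \<in> carrier L" using v part_carrier by blast
  have Cc: "x \<in> carrier L" if "x \<in> C" for x using subspD(2)[OF sC that] .
  show img: "subsp (bracket L v ` C)"
  proof (rule subspI)
    show "\<zero> \<in> bracket L v ` C" using bracket_zero(2)[OF vc] subspD(3)[OF sC] by (metis imageI)
    show "bracket L v ` C \<subseteq> carrier L" using Cc vc bracket_closed by blast
  next
    fix x y assume "x \<in> bracket L v ` C" "y \<in> bracket L v ` C"
    then obtain a b where "a \<in> C" "b \<in> C" "x = bracket L v a" "y = bracket L v b" by blast
    then show "x \<oplus> y \<in> bracket L v ` C"
      using bracket_add_right[OF vc, of a b] Cc subspD(4)[OF sC] by (metis imageI)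
  next
    fix c x assume "x \<in> bracket L v ` C"
    then obtain a where "a \<in> C" "x = bracket L v a" by blast
    then show "c \<odot> x \<in> bracket L v ` C"
      using bracket_smult_right[OF vc, of a c] Cc subspD(5)[OF sC] by (metis imageI)
  qed
  show "bracket L v ` C \<subseteq> part L (i + j)" using bracket_part[OF v] closed_inD(2)[OF C] by blast
  fix y assume y: "y \<in> part L (i + j)" "\<forall>k. y \<in> bracket L v ` C <+> B k"
  have yc: "y \<in> carrier L" using y part_carrier by blast
  have "\<exists>c\<in>C. y \<ominus> bracket L v c \<in> B k" for k using y(2) mem_sum[OF img B_subsp] by blast
  then obtain c where c: "\<And>k. c k \<in> C" "\<And>k. y \<ominus> bracket L v (c k) \<in> B k" by metis
  have cc: "c k \<in> part L j" "c k \<in> carrier L" for k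
    using c(1) closed_inD(2)[OF C] part_carrier by blast+
  define E where "E k = (C <+> B k) \<inter> {x \<in> carrier L. bracket L v x \<in> B k} \<inter> part L j" for k
  have sB: "subsp (C <+> B k)" "subsp {x \<in> carrier L. bracket L v x \<in> B k}" for k
    using subsp_sum[OF sC B_subsp] subsp_bracket_preimage(1)[OF B_subsp vc] .
  obtain x where x: "x \<in> part L j" "\<And>k. x \<ominus> c k \<in> E k"
  proof (rule complete_coarser_part[of E j c])
    show "subsp (E k)" for k unfolding E_def by (intro subsp_Int sB subsp_part)
    show "B k \<inter> part L j \<subseteq> E k" for k
      unfolding E_def using sum_upper(2)[OF sC B_subsp] B_bracket[OF vc] part_carrier by blast
    show "E k \<subseteq> part L j" for k unfolding E_def by blast
    show "E (Suc k) \<subseteq> E k" for k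
      unfolding E_def using sum_mono[OF subset_refl B_dec, of C k] B_dec by blast
    show "c (Suc k) \<ominus> c k \<in> E k" for k
    proof -
      have "c (Suc k) \<ominus> c k \<in> C" by (rule subsp_diff[OF sC c(1) c(1)])
      moreover have "(y \<ominus> bracket L v (c k)) \<ominus> (y \<ominus> bracket L v (c (Suc k))) \<in> B k"
        using c(2)[of "Suc k"] B_dec by (intro subsp_diff[OF B_subsp c(2)]) blast
      then have "bracket L v (c (Suc k) \<ominus> c k) \<in> B k"
        using diff_diff(3)[of y "bracket L v (c k)" "bracket L v (c (Suc k))"]
          bracket_diff(2)[OF cc(2) cc(2) vc] yc cc vc bracket_closed by simp
      ultimately show ?thesis
        unfolding E_def using sum_upper(1)[OF sC B_subsp] closed_inD(2)[OF C] Cc by blast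
    qed
  qed (use cc in auto)
  have xc: "x \<in> carrier L" using x part_carrier by blast
  have "x \<in> C <+> B k" for k
    using x(2)[of k] c(1)[of k] sum_upper(1)[OF sC B_subsp] xc unfolding E_def
    by (intro subsp_diff_mem[OF sB(1), of x "c k"]) auto
  then have "x \<in> C" using closed_inD(3)[OF C x(1)] by blast
  have "bracket L v x \<ominus> y \<in> B k" for k
  proof -
    have "bracket L v x \<ominus> bracket L v (c k) \<in> B k"
      using x(2)[of k] bracket_diff(2)[OF xc cc(2) vc] unfolding E_def by simp
    moreover have "bracket L v (c k) \<ominus> y \<in> B k"
      by (rule subsp_diff_sym[OF B_subsp yc bracket_closed[OF vc cc(2)] c(2)])
    ultimately show ?thesis
      by (rule subsp_diff_trans[OF B_subsp bracket_closed[OF vc xc] bracket_closed[OF vc cc(2)] yc])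
  qed
  then have "bracket L v x = y" using eq_of_congruent bracket_closed[OF vc xc] yc by blast
  then show "y \<in> bracket L v ` C" using \<open>x \<in> C\<close> by blast
qed

lemma closed_in_span_Union:
  assumes "finite \<C>" "\<And>C. C \<in> \<C> \<Longrightarrow> closed_in n C"
  shows "closed_in n (sp (\<Union>\<C>))"
  using assms
proof (induction \<C>)
  case empty
  have "sp {} = {\<zero>}"
    using sp_least[OF _ subsp_zero, of "{}"] subspD(3)[OF sp_subspace[of "{}"]] by blast
  then show ?case using closed_in_zero by simp
next
  case (insert C \<C>)
  have c: "C \<subseteq> carrier L" "\<Union>\<C> \<subseteq> carrier L"
    using insert.prems closed_inD(1) subspD(1) by blast+
  have "sp (\<Union>(insert C \<C>)) = C <+> sp (\<Union>\<C>)"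
    using sp_Un[OF c] sp_eq[of C] closed_inD(1)[of n C] insert.prems by simp
  then show ?case using closed_in_sum insert by simp
qed

end

text \<open>
  In each quotient by a \<open>B m\<close> some power vanishes in the given degree. This makes the error term of
  \<open>left_power_approx\<close> arbitrarily small.
\<close>

locale complete_generated = degreewise_generated + complete_filtration +
  assumes B_left_power: "\<exists>r. left_power r \<inter> part L n \<subseteq> B m"
begin

text \<open>
  The span \<open>T\<close> of the generator brackets is a finite sum of images of closed subspaces, hence closed. It
  is contained in the power and dense in it, so the two agree.
\<close>

lemma closed_in_left_power: "closed_in n (left_power k \<inter> part L n)"
proof (induction k arbitrary: n)
  case 0
  then show ?case using closed_in_part subspD(1)[OF subsp_part] by (simp add: Int_absorb1)
next
  case (Suc k)
  let ?C = "\<lambda>i v. bracket L v ` (left_power k \<inter> part L (n - i))"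
  let ?\<C> = "\<Union>i\<in>{..n}. ?C i ` V i"
  have fin: "finite ?\<C>" using V_finite by blast
  have closed: "closed_in n C" if "C \<in> ?\<C>" for C
  proof -
    from that obtain i v where "i \<le> n" "v \<in> V i" "C = ?C i v" by blast
    then show ?thesis
      using closed_in_bracket_image[of v i "n - i"] V_part[of i] Suc.IH[of "n - i"] by auto
  qed
  have eq: "\<Union>?\<C> = generator_brackets k n" unfolding generator_brackets_def by blast
  have T: "closed_in n (sp (generator_brackets k n))"
    using closed_in_span_Union[OF fin closed] unfolding eq .
  let ?T = "sp (generator_brackets k n)"
  note sT = closed_inD(1)[OF T] and sP = subsp_left_power_part[of "Suc k" n]
  have sub: "?T \<subseteq> left_power (Suc k) \<inter> part L n"
    by (intro sp_least generator_brackets_subset sP)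
  have approx: "left_power (Suc k) \<inter> part L n \<subseteq> ?T <+> B m" for m
  proof -
    obtain r where r: "left_power r \<inter> part L n \<subseteq> B m" using B_left_power by blast
    have "left_power (Suc k + r) \<inter> part L n \<subseteq> B m" using r left_power_antimono[of r "Suc k + r"] by auto
    then have "generator_brackets k n \<union> (left_power (Suc k + r) \<inter> part L n) \<subseteq> ?T <+> B m"
      using sum_upper[OF sT B_subsp] sp_superset[OF generator_brackets_carrier] by blast
    then have "sp (generator_brackets k n \<union> (left_power (Suc k + r) \<inter> part L n)) \<subseteq> ?T <+> B m"
      by (intro sp_least subsp_sum sT B_subsp)
    then show ?thesis using left_power_approx by blast
  qed
  have "x \<in> left_power (Suc k) \<inter> part L n"
    if x: "x \<in> part L n" "\<forall>m. x \<in> (left_power (Suc k) \<inter> part L n) <+> B m" for x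
  proof -
    have "(left_power (Suc k) \<inter> part L n) <+> B m \<subseteq> ?T <+> B m" for m
      by (intro sum_least sP B_subsp subsp_sum sT approx sum_upper(2))
    then have "x \<in> ?T" using closed_inD(3)[OF T x(1)] x(2) by blast
    then show ?thesis using sub by blast
  qed
  then show ?case unfolding closed_in_def using sP by blast
qed

end

section \<open>Quotients by graded ideals\<close>

lemma quotient_lie_simps [simp]:
  "carrier (quotient_lie L I) = a_rcosets\<^bsub>L\<^esub> I" "\<zero>\<^bsub>quotient_lie L I\<^esub> = I"
  "X \<oplus>\<^bsub>quotient_lie L I\<^esub> Y = X <+>\<^bsub>L\<^esub> Y"
  "c \<odot>\<^bsub>quotient_lie L I\<^esub> X = (\<Union>x\<in>X. I +>\<^bsub>L\<^esub> (c \<odot>\<^bsub>L\<^esub> x))"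
  "bracket (quotient_lie L I) X Y = (\<Union>x\<in>X. \<Union>y\<in>Y. I +>\<^bsub>L\<^esub> bracket L x y)"
  "part (quotient_lie L I) n = (\<lambda>x. I +>\<^bsub>L\<^esub> x) ` part L n"
  by (simp_all add: quotient_lie_def)

context lie_algebra
begin

lemma mem_coset:
  assumes "subsp I" "x \<in> carrier L"
  shows "z \<in> I +> x \<longleftrightarrow> z \<in> carrier L \<and> z \<ominus> x \<in> I"
proof
  assume "z \<in> I +> x"
  then obtain h where "h \<in> I" "z = h \<oplus> x" unfolding a_r_coset_def' by blast
  then show "z \<in> carrier L \<and> z \<ominus> x \<in> I"
    using assms subspD(2)[OF assms(1)] by (auto simp: diff_arith)
next
  assume z: "z \<in> carrier L \<and> z \<ominus> x \<in> I"
  then have "z = (z \<ominus> x) \<oplus> x" using assms by (simp add: diff_arith)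
  then show "z \<in> I +> x" using z unfolding a_r_coset_def' by blast
qed

lemma coset_self: "subsp I \<Longrightarrow> x \<in> carrier L \<Longrightarrow> x \<in> I +> x"
  using mem_coset[of I x x] subspD(3)[of I] by simp

lemma coset_eq_iff:
  assumes "subsp I" "x \<in> carrier L" "y \<in> carrier L"
  shows "I +> x = I +> y \<longleftrightarrow> x \<ominus> y \<in> I"
proof
  assume "I +> x = I +> y"
  then show "x \<ominus> y \<in> I" using coset_self[OF assms(1,2)] mem_coset[OF assms(1,3)] by blast
next
  assume xy: "x \<ominus> y \<in> I"
  have "z \<ominus> x \<in> I \<longleftrightarrow> z \<ominus> y \<in> I" if "z \<in> carrier L" for z
    using subsp_diff_trans[OF assms(1) that assms(2,3) _ xy]
      subsp_diff_trans[OF assms(1) that assms(3,2) _ subsp_diff_sym[OF assms xy]] by blast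
  then show "I +> x = I +> y"
    using mem_coset[OF assms(1,2)] mem_coset[OF assms(1,3)] by blast
qed

lemma coset_zero:
  assumes "subsp I"
  shows "I +> \<zero> = I"
proof (rule Set.set_eqI)
  fix z show "z \<in> I +> \<zero> \<longleftrightarrow> z \<in> I"
    unfolding mem_coset[OF assms M.zero_closed] using subspD(2)[OF assms, of z] diff_zero[of z] by auto
qed

lemma coset_eq_ideal_iff: "subsp I \<Longrightarrow> x \<in> carrier L \<Longrightarrow> I +> x = I \<longleftrightarrow> x \<in> I"
  using coset_eq_iff[of I x \<zero>] coset_zero[of I] by simp

lemma sum_coset:
  assumes "subsp I" "subsp J" "J \<subseteq> I" "x \<in> carrier L"
  shows "I <+> (J +> x) = I +> x"
proof
  show "I <+> (J +> x) \<subseteq> I +> x"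
  proof
    fix z assume "z \<in> I <+> (J +> x)"
    then obtain i y where iy: "i \<in> I" "y \<in> J +> x" "z = i \<oplus> y" unfolding set_add_def' by blast
    then have y: "y \<in> carrier L" "y \<ominus> x \<in> I" using mem_coset[OF assms(2,4)] assms(3) by auto
    have i: "i \<in> carrier L" using iy(1) subspD(2)[OF assms(1)] by blast
    have "z \<ominus> x = i \<oplus> (y \<ominus> x)" using i y assms(4) iy(3) by (simp add: M.minus_eq M.a_ac)
    then show "z \<in> I +> x"
      using mem_coset[OF assms(1,4)] subspD(4)[OF assms(1) iy(1) y(2)] i y(1) iy(3) by simp
  qed
  show "I +> x \<subseteq> I <+> (J +> x)"
    using coset_self[OF assms(2,4)] unfolding a_r_coset_def' set_add_def' by blast
qed

end

locale lie_ideal = lie_algebra +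
  fixes I :: "'a set"
  assumes ideal: "graded_ideal L I"
begin

lemma subsp_ideal: "subsp I"
  and graded_I: "graded I"
  and ideal_bracket: "x \<in> carrier L \<Longrightarrow> y \<in> I \<Longrightarrow> bracket L x y \<in> I"
    "x \<in> carrier L \<Longrightarrow> y \<in> I \<Longrightarrow> bracket L y x \<in> I"
proof -
  show "subsp I" using ideal unfolding graded_ideal_def by blast
  then show "graded I" using ideal unfolding graded_ideal_def by (simp only: graded_iff)
  show "x \<in> carrier L \<Longrightarrow> y \<in> I \<Longrightarrow> bracket L x y \<in> I"
    "x \<in> carrier L \<Longrightarrow> y \<in> I \<Longrightarrow> bracket L y x \<in> I"
    using ideal unfolding graded_ideal_def by blast+
qed

abbreviation quotient :: "'a set graded_lie" where
  "quotient \<equiv> quotient_lie L I"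

lemma quotient_carrier: "X \<in> carrier quotient \<longleftrightarrow> (\<exists>x\<in>carrier L. X = I +> x)"
  by (auto simp: A_RCOSETS_def')

lemma coset_in_quotient: "x \<in> carrier L \<Longrightarrow> I +> x \<in> carrier quotient"
  using quotient_carrier by blast

lemma quotient_add:
  assumes "x \<in> carrier L" "y \<in> carrier L"
  shows "(I +> x) <+> (I +> y) = I +> (x \<oplus> y)"
proof -
  have "z \<in> (I +> x) <+> (I +> y) \<longleftrightarrow> z \<in> carrier L \<and> z \<ominus> (x \<oplus> y) \<in> I" for z
  proof
    assume "z \<in> (I +> x) <+> (I +> y)"
    then obtain a b where ab: "a \<in> I +> x" "b \<in> I +> y" "z = a \<oplus> b" unfolding set_add_def' by blast
    then have c: "a \<in> carrier L" "a \<ominus> x \<in> I" "b \<in> carrier L" "b \<ominus> y \<in> I"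
      using mem_coset[OF subsp_ideal] assms by auto
    then show "z \<in> carrier L \<and> z \<ominus> (x \<oplus> y) \<in> I"
      using subspD(4)[OF subsp_ideal c(2,4)] diff_add(1)[of a b x y] assms ab(3) by simp
  next
    assume z: "z \<in> carrier L \<and> z \<ominus> (x \<oplus> y) \<in> I"
    have "(z \<ominus> y) \<ominus> x = z \<ominus> (x \<oplus> y)"
      using z assms by (simp add: M.minus_eq M.a_ac M.minus_add)
    then have "z \<ominus> y \<in> I +> x" using mem_coset[OF subsp_ideal assms(1)] z assms(2) by simp
    moreover have "z = (z \<ominus> y) \<oplus> y" using z assms by (simp add: diff_arith)
    ultimately show "z \<in> (I +> x) <+> (I +> y)"
      using coset_self[OF subsp_ideal assms(2)] unfolding set_add_def' by blast
  qed
  then show ?thesis using mem_coset[OF subsp_ideal, of "x \<oplus> y"] assms by blast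
qed

lemma quotient_smult:
  assumes "x \<in> carrier L"
  shows "c \<odot>\<^bsub>quotient\<^esub> (I +> x) = I +> (c \<odot> x)"
proof -
  have eq: "I +> (c \<odot> z) = I +> (c \<odot> x)" if "z \<in> I +> x" for z
  proof -
    have "z \<in> carrier L" "z \<ominus> x \<in> I" using that mem_coset[OF subsp_ideal assms] by auto
    then have "c \<odot> z \<ominus> c \<odot> x \<in> I"
      using subspD(5)[OF subsp_ideal, of "z \<ominus> x" c] assms by (simp add: diff_smult)
    then show ?thesis using coset_eq_iff[OF subsp_ideal] assms \<open>z \<in> carrier L\<close> by simp
  qed
  have ne: "I +> x \<noteq> {}" using coset_self[OF subsp_ideal assms] by blast
  show ?thesis unfolding quotient_lie_simps by (intro SUP_eq_const ne eq)
qed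

lemma quotient_bracket:
  assumes "x \<in> carrier L" "y \<in> carrier L"
  shows "bracket quotient (I +> x) (I +> y) = I +> bracket L x y"
proof -
  have eq: "I +> bracket L a b = I +> bracket L x y" if "a \<in> I +> x" "b \<in> I +> y" for a b
  proof -
    have a: "a \<in> carrier L" "a \<ominus> x \<in> I" using that mem_coset[OF subsp_ideal assms(1)] by auto
    have b: "b \<in> carrier L" "b \<ominus> y \<in> I" using that mem_coset[OF subsp_ideal assms(2)] by auto
    have "bracket L a b \<ominus> bracket L x b \<in> I"
      using ideal_bracket(2)[OF b(1) a(2)] bracket_diff(1)[OF a(1) assms(1) b(1)] by simp
    moreover have "bracket L x b \<ominus> bracket L x y \<in> I"
      using ideal_bracket(1)[OF assms(1) b(2)] bracket_diff(2)[OF b(1) assms(2,1)] by simp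
    ultimately have "bracket L a b \<ominus> bracket L x y \<in> I"
      by (rule subsp_diff_trans[OF subsp_ideal, rotated 3]) (simp_all add: bracket_closed a b assms)
    then show ?thesis using coset_eq_iff[OF subsp_ideal] assms a b bracket_closed by simp
  qed
  have ne: "I +> x \<noteq> {}" "I +> y \<noteq> {}"
    using coset_self[OF subsp_ideal assms(1)] coset_self[OF subsp_ideal assms(2)] by blast+
  show ?thesis unfolding quotient_lie_simps by (intro SUP_eq_const ne eq)
qed

lemma field_rat: "field rat_field"
  using vectorspace_axioms unfolding vectorspace_def by blast

lemma vectorspace_quotient: "vectorspace rat_field quotient"
proof (rule vs_criteria[OF field_rat])
  show "\<zero>\<^bsub>quotient\<^esub> \<in> carrier quotient"
    unfolding quotient_carrier using coset_zero[OF subsp_ideal] by (intro bexI[of _ \<zero>]) auto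
  show "\<forall>v w. v \<in> carrier quotient \<and> w \<in> carrier quotient \<longrightarrow> v \<oplus>\<^bsub>quotient\<^esub> w \<in> carrier quotient"
    unfolding quotient_carrier by (metis M.a_closed quotient_add quotient_lie_simps(3))
  show "\<forall>v\<in>carrier quotient. \<exists>w\<in>carrier quotient. v \<oplus>\<^bsub>quotient\<^esub> w = \<zero>\<^bsub>quotient\<^esub>"
  proof
    fix X assume "X \<in> carrier quotient"
    then obtain x where x: "x \<in> carrier L" "X = I +> x" using quotient_carrier by blast
    then have "X \<oplus>\<^bsub>quotient\<^esub> (I +> (\<ominus> x)) = \<zero>\<^bsub>quotient\<^esub>"
      using quotient_add[of x "\<ominus> x"] coset_zero[OF subsp_ideal] by (simp add: M.r_neg)
    moreover have "I +> (\<ominus> x) \<in> carrier quotient" using x(1) quotient_carrier by blast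
    ultimately show "\<exists>w\<in>carrier quotient. X \<oplus>\<^bsub>quotient\<^esub> w = \<zero>\<^bsub>quotient\<^esub>" by blast
  qed
  show "\<forall>c v. c \<in> carrier rat_field \<and> v \<in> carrier quotient \<longrightarrow> c \<odot>\<^bsub>quotient\<^esub> v \<in> carrier quotient"
    unfolding quotient_carrier by (metis smult_cl quotient_smult)
  show "\<forall>v w. v \<in> carrier quotient \<and> w \<in> carrier quotient \<longrightarrow> v \<oplus>\<^bsub>quotient\<^esub> w = w \<oplus>\<^bsub>quotient\<^esub> v"
    unfolding quotient_carrier by (metis M.a_comm quotient_add quotient_lie_simps(3))
  show "\<forall>v w x. v \<in> carrier quotient \<and> w \<in> carrier quotient \<and> x \<in> carrier quotient \<longrightarrow>
      (v \<oplus>\<^bsub>quotient\<^esub> w) \<oplus>\<^bsub>quotient\<^esub> x = v \<oplus>\<^bsub>quotient\<^esub> (w \<oplus>\<^bsub>quotient\<^esub> x)"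
    unfolding quotient_carrier by (metis M.a_assoc M.a_closed quotient_add quotient_lie_simps(3))
  show "\<forall>v\<in>carrier quotient. v \<oplus>\<^bsub>quotient\<^esub> \<zero>\<^bsub>quotient\<^esub> = v"
  proof
    fix X assume "X \<in> carrier quotient"
    then obtain x where "x \<in> carrier L" "X = I +> x" using quotient_carrier by blast
    then show "X \<oplus>\<^bsub>quotient\<^esub> \<zero>\<^bsub>quotient\<^esub> = X"
      using quotient_add[of x \<zero>] coset_zero[OF subsp_ideal] by simp
  qed
  show "\<forall>a b v. a \<in> carrier rat_field \<and> b \<in> carrier rat_field \<and> v \<in> carrier quotient \<longrightarrow>
      (a \<otimes>\<^bsub>rat_field\<^esub> b) \<odot>\<^bsub>quotient\<^esub> v = a \<odot>\<^bsub>quotient\<^esub> (b \<odot>\<^bsub>quotient\<^esub> v)"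
    unfolding quotient_carrier by (metis smult_assoc1 smult_cl quotient_smult)
  show "\<forall>v\<in>carrier quotient. \<one>\<^bsub>rat_field\<^esub> \<odot>\<^bsub>quotient\<^esub> v = v"
  proof
    fix X assume "X \<in> carrier quotient"
    then obtain x where "x \<in> carrier L" "X = I +> x" using quotient_carrier by blast
    then show "\<one>\<^bsub>rat_field\<^esub> \<odot>\<^bsub>quotient\<^esub> X = X"
      using quotient_smult[of x 1] smult_one[of x] by (simp del: quotient_lie_simps)
  qed
  show "\<forall>a b v. a \<in> carrier rat_field \<and> b \<in> carrier rat_field \<and> v \<in> carrier quotient \<longrightarrow>
      (a \<oplus>\<^bsub>rat_field\<^esub> b) \<odot>\<^bsub>quotient\<^esub> v = (a \<odot>\<^bsub>quotient\<^esub> v) \<oplus>\<^bsub>quotient\<^esub> (b \<odot>\<^bsub>quotient\<^esub> v)"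
    unfolding quotient_carrier
    by (metis smult_l_distr smult_cl quotient_smult quotient_add quotient_lie_simps(3))
  show "\<forall>a v w. a \<in> carrier rat_field \<and> v \<in> carrier quotient \<and> w \<in> carrier quotient \<longrightarrow>
      a \<odot>\<^bsub>quotient\<^esub> (v \<oplus>\<^bsub>quotient\<^esub> w) = (a \<odot>\<^bsub>quotient\<^esub> v) \<oplus>\<^bsub>quotient\<^esub> (a \<odot>\<^bsub>quotient\<^esub> w)"
    unfolding quotient_carrier
    by (metis smult_r_distr smult_cl M.a_closed quotient_smult quotient_add quotient_lie_simps(3))
qed

lemma quotient_image_submodule:
  assumes "subsp S"
  shows "LinearCombinations.submodule rat_field ((\<lambda>x. I +> x) ` S) quotient"
proof -
  interpret Q: vectorspace rat_field quotient by (rule vectorspace_quotient)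
  show ?thesis
  proof (unfold_locales)
    show "(\<lambda>x. I +> x) ` S \<subseteq> carrier quotient"
      using quotient_carrier subspD(2)[OF assms] by blast
    show "\<zero>\<^bsub>quotient\<^esub> \<in> (\<lambda>x. I +> x) ` S"
      using coset_zero[OF subsp_ideal] subspD(3)[OF assms] by force
  next
    fix v w assume "v \<in> (\<lambda>x. I +> x) ` S" "w \<in> (\<lambda>x. I +> x) ` S"
    then obtain x y where "x \<in> S" "y \<in> S" "v = I +> x" "w = I +> y" by blast
    then show "v \<oplus>\<^bsub>quotient\<^esub> w \<in> (\<lambda>x. I +> x) ` S"
      using quotient_add[of x y] subspD(2,4)[OF assms] by simp
  next
    fix c v assume "v \<in> (\<lambda>x. I +> x) ` S"
    then obtain x where "x \<in> S" "v = I +> x" by blast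
    then show "c \<odot>\<^bsub>quotient\<^esub> v \<in> (\<lambda>x. I +> x) ` S"
      using quotient_smult[of x c] subspD(2,5)[OF assms] by (metis image_eqI)
  qed
qed

text \<open>
  Spans in the quotient are spans over the ideal. Through this equivalence the finiteness conditions on
  quotients become conditions on \<open>L\<close>.
\<close>

lemma quotient_span_iff:
  assumes F: "F \<subseteq> carrier L" and x: "x \<in> carrier L"
  shows "I +> x \<in> lin_span quotient ((\<lambda>x. I +> x) ` F) \<longleftrightarrow> x \<in> sp (I \<union> F)"
proof
  interpret Q: vectorspace rat_field quotient by (rule vectorspace_quotient)
  have IF: "I \<union> F \<subseteq> carrier L" using F subspD(1)[OF subsp_ideal] by blast
  note sub = sp_subspace[OF IF]
  have FQ: "(\<lambda>x. I +> x) ` F \<subseteq> carrier quotient" using F quotient_carrier by blast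
  {
    assume "I +> x \<in> lin_span quotient ((\<lambda>x. I +> x) ` F)"
    moreover have "lin_span quotient ((\<lambda>x. I +> x) ` F) \<subseteq> (\<lambda>x. I +> x) ` sp (I \<union> F)"
      unfolding lin_span_def[of quotient]
      by (rule Q.span_is_subset[OF image_mono quotient_image_submodule[OF sub]])
        (use sp_superset[OF IF] in blast)
    ultimately obtain y where y: "y \<in> sp (I \<union> F)" "I +> x = I +> y" by blast
    then have "x \<ominus> y \<in> I" using coset_eq_iff[OF subsp_ideal x] subspD(2)[OF sub] by blast
    then have "x \<ominus> y \<in> sp (I \<union> F)" using sp_superset[OF IF] by blast
    then show "x \<in> sp (I \<union> F)" using subsp_diff_mem[OF sub x _ y(1)] by blast
  }
  assume "x \<in> sp (I \<union> F)"
  have span: "LinearCombinations.submodule rat_field (lin_span quotient ((\<lambda>x. I +> x) ` F)) quotient"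
    unfolding lin_span_def by (rule Q.span_is_submodule[OF FQ])
  let ?S = "{y \<in> carrier L. I +> y \<in> lin_span quotient ((\<lambda>x. I +> x) ` F)}"
  have zero: "I \<in> lin_span quotient ((\<lambda>x. I +> x) ` F)"
    using submodule.zero_closed[OF span] by simp
  have "subsp ?S"
  proof (rule subspI)
    fix y z assume "y \<in> ?S" "z \<in> ?S"
    then show "y \<oplus> z \<in> ?S"
      using submodule.m_closed[OF span, of "I +> y" "I +> z"] quotient_add[of y z] by simp
  next
    fix c y assume "y \<in> ?S"
    then show "c \<odot> y \<in> ?S"
      using submodule.smult_closed[OF span, of c "I +> y"] quotient_smult[of y c]
      by (simp del: quotient_lie_simps)
  qed (use zero coset_zero[OF subsp_ideal] in auto)
  moreover have "I \<union> F \<subseteq> ?S"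
  proof
    fix y assume y: "y \<in> I \<union> F"
    then have "I +> y \<in> lin_span quotient ((\<lambda>x. I +> x) ` F)"
    proof
      assume "y \<in> I"
      then show ?thesis
        using coset_eq_ideal_iff[OF subsp_ideal, of y] subspD(2)[OF subsp_ideal, of y] zero by simp
    next
      assume "y \<in> F"
      then show ?thesis using Q.in_own_span[OF FQ] unfolding lin_span_def by blast
    qed
    then show "y \<in> ?S" using y IF by blast
  qed
  ultimately have "sp (I \<union> F) \<subseteq> ?S" using sp_least by blast
  then show "I +> x \<in> lin_span quotient ((\<lambda>x. I +> x) ` F)" using \<open>x \<in> sp (I \<union> F)\<close> by blast
qed

lemma fin_dim_quotient_iff: "fin_dim_lie quotient \<longleftrightarrow> finite_over I (carrier L)"
proof -
  interpret Q: vectorspace rat_field quotient by (rule vectorspace_quotient)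
  have cosets: "A \<subseteq> carrier quotient \<Longrightarrow> finite A \<Longrightarrow> \<exists>F\<subseteq>carrier L. finite F \<and> A = (\<lambda>x. I +> x) ` F" for A
    using finite_subset_image[of A "\<lambda>x. I +> x" "carrier L"] quotient_carrier by blast
  have span: "lin_span quotient ((\<lambda>x. I +> x) ` F) = carrier quotient \<longleftrightarrow> carrier L \<subseteq> sp (I \<union> F)"
    if F: "F \<subseteq> carrier L" for F
  proof -
    have "(\<lambda>x. I +> x) ` F \<subseteq> carrier quotient" using F quotient_carrier by blast
    then have "lin_span quotient ((\<lambda>x. I +> x) ` F) \<subseteq> carrier quotient"
      unfolding lin_span_def by (rule Q.span_is_subset2)
    then have "lin_span quotient ((\<lambda>x. I +> x) ` F) = carrier quotient \<longleftrightarrow>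
        (\<forall>X\<in>carrier quotient. X \<in> lin_span quotient ((\<lambda>x. I +> x) ` F))" by blast
    also have "\<dots> \<longleftrightarrow> (\<forall>x\<in>carrier L. I +> x \<in> lin_span quotient ((\<lambda>x. I +> x) ` F))"
      unfolding Ball_def quotient_carrier by auto
    also have "\<dots> \<longleftrightarrow> carrier L \<subseteq> sp (I \<union> F)"
      using quotient_span_iff[OF F] by (simp add: subset_eq)
    finally show ?thesis .
  qed
  show ?thesis
  proof
    assume "fin_dim_lie quotient"
    then obtain A where A: "finite A" "A \<subseteq> carrier quotient" "lin_span quotient A = carrier quotient"
      unfolding fin_dim_lie_def Q.fin_dim_def lin_span_def by blast
    obtain F where F: "F \<subseteq> carrier L" "finite F" "A = (\<lambda>x. I +> x) ` F" using cosets[OF A(2,1)] by blast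
    show "finite_over I (carrier L)"
      unfolding finite_over_def using F span[OF F(1)] A(3) by blast
  next
    assume "finite_over I (carrier L)"
    then obtain F where F: "finite F" "F \<subseteq> carrier L" "carrier L \<subseteq> sp (I \<union> F)"
      unfolding finite_over_def by blast
    have "(\<lambda>x. I +> x) ` F \<subseteq> carrier quotient" using F(2) quotient_carrier by blast
    moreover have "Q.gen_set ((\<lambda>x. I +> x) ` F)" using span[OF F(2)] F(3) unfolding lin_span_def by simp
    ultimately show "fin_dim_lie quotient"
      using F(1) unfolding fin_dim_lie_def Q.fin_dim_def by blast
  qed
qed

lemma finite_type_quotientD:
  assumes "finite_type quotient"
  shows "\<exists>F. finite F \<and> F \<subseteq> part L n \<and> part L n \<subseteq> sp (F \<union> I)"
proof -
  interpret Q: vectorspace rat_field quotient by (rule vectorspace_quotient)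
  let ?P = "(\<lambda>x. I +> x) ` part L n"
  let ?R = "quotient\<lparr>carrier := ?P\<rparr>"
  have sub: "LinearCombinations.submodule rat_field ?P quotient"
    by (rule quotient_image_submodule[OF subsp_part])
  have "vectorspace rat_field ?R"
    using Q.submodule_is_module[OF sub] field_rat unfolding vectorspace_def by blast
  then obtain A where A: "finite A" "A \<subseteq> ?P" "LinearCombinations.module.span rat_field ?R A = ?P"
    using assms vectorspace.fin_dim_def[of rat_field ?R] unfolding finite_type_def by auto
  obtain F where F: "F \<subseteq> part L n" "finite F" "A = (\<lambda>x. I +> x) ` F"
    using finite_subset_image[OF A(1,2)] by blast
  have Fc: "F \<subseteq> carrier L" using F(1) part_carrier by blast
  have "lin_span quotient A = ?P"
    using Q.span_li_not_depend(1)[OF A(2) sub] A(3) unfolding lin_span_def by simp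
  then have "part L n \<subseteq> sp (I \<union> F)"
    using quotient_span_iff[OF Fc] part_carrier F(3) by blast
  then show ?thesis using F by (metis Un_commute)
qed

lemma iterated_bracket_quotient:
  "iterated_bracket L k x \<Longrightarrow> iterated_bracket quotient k (I +> x)"
proof (induction rule: iterated_bracket.induct)
  case (single x)
  then show ?case by (intro iterated_bracket.single coset_in_quotient)
next
  case (bracket i x j y)
  then have "x \<in> carrier L" "y \<in> carrier L" using iterated_bracket_pos by blast+
  from quotient_bracket[OF this] show ?case
    using iterated_bracket.bracket[OF bracket.IH] by (simp only:)
qed

lemma iterated_bracket_quotientE:
  "iterated_bracket quotient k X \<Longrightarrow> \<exists>x. iterated_bracket L k x \<and> X = I +> x"
proof (induction rule: iterated_bracket.induct)
  case (single X)
  then obtain x where x: "x \<in> carrier L" "X = I +> x" using quotient_carrier by blast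
  show ?case by (intro exI[of _ x] conjI iterated_bracket.single x)
next
  case (bracket i X j Y)
  then obtain x y where xy: "iterated_bracket L i x" "X = I +> x" "iterated_bracket L j y" "Y = I +> y"
    by blast
  then have "x \<in> carrier L" "y \<in> carrier L" using iterated_bracket_pos by blast+
  from quotient_bracket[OF this] have "bracket quotient X Y = I +> bracket L x y"
    unfolding xy(2,4) .
  with iterated_bracket.bracket[OF xy(1,3)] show ?case by (intro exI conjI)
qed

text \<open>
  Iterated brackets of cosets are exactly the cosets of iterated brackets.
\<close>

lemma lie_power_quotient_iff:
  assumes "k \<ge> 1"
  shows "lie_power quotient k = {\<zero>\<^bsub>quotient\<^esub>} \<longleftrightarrow> lie_power L k \<subseteq> I"
proof
  interpret Q: vectorspace rat_field quotient by (rule vectorspace_quotient)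
  let ?X = "{X. iterated_bracket quotient k X}"
  have X: "?X \<subseteq> carrier quotient"
    using iterated_bracket_quotientE iterated_bracket_pos quotient_carrier by blast
  {
    assume zero: "lie_power quotient k = {\<zero>\<^bsub>quotient\<^esub>}"
    have "x \<in> I" if "iterated_bracket L k x" for x
    proof -
      have "I +> x \<in> lie_power quotient k"
        using iterated_bracket_quotient[OF that] Q.in_own_span[OF X] unfolding lie_power_def lin_span_def
        by blast
      then show ?thesis
        using zero coset_eq_ideal_iff[OF subsp_ideal] iterated_bracket_pos[OF that] by simp
    qed
    then show "lie_power L k \<subseteq> I" unfolding lie_power_def by (intro sp_least subsp_ideal) blast
  }
  assume sub: "lie_power L k \<subseteq> I"
  have "?X \<subseteq> (\<lambda>x. I +> x) ` {\<zero>}"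
  proof
    fix X assume "X \<in> ?X"
    then obtain x where x: "iterated_bracket L k x" "X = I +> x" using iterated_bracket_quotientE by blast
    then have "x \<in> I" using iterated_bracket_lie_power sub by blast
    then have "I +> x = I +> \<zero>"
      using coset_eq_iff[OF subsp_ideal, of x \<zero>] iterated_bracket_pos[OF x(1)] by simp
    then show "X \<in> (\<lambda>x. I +> x) ` {\<zero>}" using x(2) by blast
  qed
  then have "lie_power quotient k \<subseteq> (\<lambda>x. I +> x) ` {\<zero>}"
    unfolding lie_power_def lin_span_def
    by (rule Q.span_is_subset[OF _ quotient_image_submodule[OF subsp_zero]])
  moreover have "\<zero>\<^bsub>quotient\<^esub> \<in> lie_power quotient k"
    unfolding lie_power_def lin_span_def by (rule submodule.zero_closed[OF Q.span_is_submodule[OF X]])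
  ultimately show "lie_power quotient k = {\<zero>\<^bsub>quotient\<^esub>}"
    using coset_zero[OF subsp_ideal] by auto
qed

lemma nilpotent_quotient_iff: "nilpotent_lie quotient \<longleftrightarrow> (\<exists>k\<ge>1. lie_power L k \<subseteq> I)"
  unfolding nilpotent_lie_def using lie_power_quotient_iff by blast

end

context lie_algebra
begin

section \<open>The canonical ideals\<close>

text \<open>
  The shift makes the natural numbers the index set of the canonical structure, and it agrees with the
  shift in \<open>left_power\<close>.
\<close>

abbreviation canonical :: "nat \<Rightarrow> 'a set" where
  "canonical k \<equiv> canonical_ideal L (Suc k)"

lemma part_from_generators: "(\<Union>i\<in>{k..}. part L i) \<subseteq> homogeneous"
  unfolding homogeneous_def by blast

lemma graded_part_from: "graded (part_from L k)"
  unfolding part_from_def by (rule graded_span[OF part_from_generators])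

lemma part_subset_part_from: "k \<le> n \<Longrightarrow> part L n \<subseteq> part_from L k"
  unfolding part_from_def
  using sp_superset[of "\<Union>i\<in>{k..}. part L i"] part_from_generators homogeneous_carrier by blast

lemma part_from_least: "subsp S \<Longrightarrow> (\<And>n. k \<le> n \<Longrightarrow> part L n \<subseteq> S) \<Longrightarrow> part_from L k \<subseteq> S"
  unfolding part_from_def by (intro sp_least) auto

lemma component_part_from:
  assumes "x \<in> part_from L k" "n < k"
  shows "component n x = \<zero>"
proof -
  let ?S = "{x \<in> carrier L. component n x = \<zero>}"
  have "component n \<zero> = \<zero>"
    using component_of_part[OF subspD(3)[OF subsp_part]] by simp
  then have "subsp ?S"
    by (intro subspI) (auto simp: component_add component_smult smult_r_null)
  moreover have "part L i \<subseteq> ?S" if "k \<le> i" for i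
    using component_of_part[of _ i n] part_carrier that assms(2) by auto
  ultimately show ?thesis using part_from_least[of ?S k] assms(1) by blast
qed

lemma canonical_eq: "canonical k = left_power k <+> part_from L (Suc k)"
  unfolding canonical_ideal_def lie_power_Suc_eq ..

lemma graded_canonical: "graded (canonical k)"
  unfolding canonical_eq by (intro graded_sum graded_left_power graded_part_from)

lemmas subsp_canonical = gradedD(1)[OF graded_canonical]

lemma left_power_subset_canonical: "left_power k \<subseteq> canonical k"
  unfolding canonical_eq by (intro sum_upper subsp_left_power gradedD(1)[OF graded_part_from])

lemma part_subset_canonical: "k < n \<Longrightarrow> part L n \<subseteq> canonical k"
  unfolding canonical_eq
  using sum_upper(2)[OF subsp_left_power gradedD(1)[OF graded_part_from]]
    part_subset_part_from[of "Suc k" n] by (meson Suc_leI subset_trans)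

lemma canonical_least:
  assumes "subsp S" "left_power k \<subseteq> S" "\<And>n. k < n \<Longrightarrow> part L n \<subseteq> S"
  shows "canonical k \<subseteq> S"
  unfolding canonical_eq using assms
  by (intro sum_least subsp_left_power gradedD(1)[OF graded_part_from] part_from_least) auto

lemma canonical_antimono: "j \<le> k \<Longrightarrow> canonical k \<subseteq> canonical j"
  using left_power_antimono[of j k] left_power_subset_canonical[of j] part_subset_canonical[of j]
  by (intro canonical_least subsp_canonical) auto

text \<open>
  In degrees up to \<open>k\<close> the summand of high degree is invisible.
\<close>

lemma canonical_low_degree:
  assumes "x \<in> canonical k" "x \<in> part L n" "n \<le> k"
  shows "x \<in> left_power k"
proof -
  note sub = subsp_left_power gradedD(1)[OF graded_part_from]
  obtain s where s: "s \<in> left_power k" "x \<ominus> s \<in> part_from L (Suc k)" "x \<in> carrier L"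
    using assms(1) mem_sum[OF sub] unfolding canonical_eq by blast
  have sc: "s \<in> carrier L" using s(1) subspD(2)[OF subsp_left_power] by blast
  have "component n x \<ominus> component n s = \<zero>"
    using component_part_from[OF s(2), of n] component_diff[OF s(3) sc] assms(3) by simp
  then have "component n x \<ominus> component n s \<in> left_power k"
    using subspD(3)[OF subsp_left_power] by simp
  then have "component n x \<in> left_power k"
    using subsp_diff_mem[OF subsp_left_power] component_closed[OF s(3)]
      gradedD(2)[OF graded_left_power s(1)] by blast
  then show ?thesis using component_of_part[OF assms(2), of n] by simp
qed

lemma part_from_bracket:
  assumes "x \<in> carrier L" "y \<in> part_from L k"
  shows "bracket L x y \<in> part_from L k" "bracket L y x \<in> part_from L k"
proof -
  have x: "x \<in> sp homogeneous"
    using graded_eq_span[OF graded_carrier] assms(1) homogeneous_carrier by (simp add: Int_absorb1)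
  have y: "y \<in> sp (\<Union>i\<in>{k..}. part L i)" using assms(2) unfolding part_from_def .
  have c: "(\<Union>i\<in>{k..}. part L i) \<subseteq> carrier L" using part_carrier by blast
  have gen: "bracket L s t \<in> part_from L k \<and> bracket L t s \<in> part_from L k"
    if st: "s \<in> homogeneous" "t \<in> (\<Union>i\<in>{k..}. part L i)" for s t
  proof -
    obtain i j where ij: "s \<in> part L i" "t \<in> part L j" "k \<le> j"
      using st unfolding homogeneous_def by auto
    then show ?thesis
      using bracket_part[OF ij(1,2)] bracket_part[OF ij(2,1)]
        part_subset_part_from[of k "i + j"] part_subset_part_from[of k "j + i"] by auto
  qed
  show "bracket L x y \<in> part_from L k"
    by (rule bracket_span[OF gradedD(1)[OF graded_part_from] homogeneous_carrier c _ x y])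
      (use gen in blast)
  show "bracket L y x \<in> part_from L k"
    by (rule bracket_span[OF gradedD(1)[OF graded_part_from] c homogeneous_carrier _ y x])
      (use gen in blast)
qed

lemma sum_bracket:
  assumes S: "subsp S" "\<And>y. y \<in> S \<Longrightarrow> bracket L x y \<in> S"
    and T: "subsp T" "\<And>y. y \<in> T \<Longrightarrow> bracket L x y \<in> T"
    and x: "x \<in> carrier L" and y: "y \<in> S <+> T"
  shows "bracket L x y \<in> S <+> T"
proof -
  obtain s where s: "y \<in> carrier L" "s \<in> S" "y \<ominus> s \<in> T" using mem_sum[OF S(1) T(1)] y by blast
  then have "bracket L x y \<ominus> bracket L x s \<in> T"
    using T(2)[OF s(3)] bracket_diff(2)[OF s(1) subspD(2)[OF S(1) s(2)] x] by simp
  then show ?thesis by (rule sumI[OF S(1) T(1) bracket_closed[OF x s(1)] S(2)[OF s(2)]])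
qed

lemma canonical_bracket:
  assumes x: "x \<in> carrier L" and y: "y \<in> canonical k"
  shows "bracket L x y \<in> canonical k" "bracket L y x \<in> canonical k"
proof -
  note sub = subsp_left_power gradedD(1)[OF graded_part_from]
  obtain s where s: "y \<in> carrier L" "s \<in> left_power k" "y \<ominus> s \<in> part_from L (Suc k)"
    using y mem_sum[OF sub] unfolding canonical_eq by blast
  have sc: "s \<in> carrier L" using s(2) subspD(2)[OF subsp_left_power] by blast
  have "bracket L x s \<in> left_power k" "bracket L s x \<in> left_power k"
    using left_power_bracket_left[OF x s(2)] left_power_bracket[OF s(2), of x 0] x
      left_power_Suc_subset[of k] by auto
  moreover have "bracket L x y \<ominus> bracket L x s \<in> part_from L (Suc k)"
    "bracket L y x \<ominus> bracket L s x \<in> part_from L (Suc k)"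
    using part_from_bracket[OF x s(3)] bracket_diff[OF s(1) sc x] by simp_all
  ultimately show "bracket L x y \<in> canonical k" "bracket L y x \<in> canonical k"
    unfolding canonical_eq using bracket_closed x s(1) by (auto intro: sumI[OF sub])
qed

lemma graded_ideal_canonical: "graded_ideal L (canonical k)"
  unfolding graded_ideal_def
  using subsp_canonical[of k] graded_canonical[of k] canonical_bracket[of _ _ k]
    graded_iff[OF subsp_canonical[of k]] by blast

lemma canonical_structure_eq: "canonical_structure L = range canonical"
proof -
  have "\<exists>j. k = Suc j" if "k \<ge> 1" for k :: nat using that by (cases k) auto
  then show ?thesis unfolding canonical_structure_def by fastforce
qed

lemma enriched_lieD:
  assumes "enriched_lie L \<J>"
  shows "\<J> \<noteq> {}" "I \<in> \<J> \<Longrightarrow> lie_ideal L I" "I \<in> \<J> \<Longrightarrow> subsp I"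
    "I \<in> \<J> \<Longrightarrow> J \<in> \<J> \<Longrightarrow> \<exists>K\<in>\<J>. K \<subseteq> I \<inter> J" "\<Inter>\<J> = {\<zero>}"
    "I \<in> \<J> \<Longrightarrow> fin_dim_lie (quotient_lie L I)" "I \<in> \<J> \<Longrightarrow> nilpotent_lie (quotient_lie L I)"
proof -
  show "I \<in> \<J> \<Longrightarrow> lie_ideal L I"
    using assms lie_algebra_axioms unfolding enriched_lie_def lie_ideal_def lie_ideal_axioms_def by blast
qed (use assms in \<open>auto simp: enriched_lie_def graded_ideal_def\<close>)

text \<open>
  Nilpotency of the quotient puts a power into \<open>I\<close>. Finite dimensionality puts the high degrees into \<open>I\<close>:
  finitely many elements span \<open>L\<close> over \<open>I\<close>, and beyond all their degrees \<open>I\<close> is everything.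
\<close>

lemma enriched_contains_canonical:
  assumes "enriched_lie L \<J>" "I \<in> \<J>"
  obtains k where "canonical k \<subseteq> I"
proof -
  interpret lie_ideal L I by (rule enriched_lieD(2)[OF assms])
  obtain j where j: "left_power j \<subseteq> I"
  proof -
    obtain k where "k \<ge> 1" "lie_power L k \<subseteq> I"
      using enriched_lieD(7)[OF assms] nilpotent_quotient_iff by blast
    then show thesis using that[of "k - 1"] lie_power_Suc_eq[of "k - 1"] by simp
  qed
  obtain F where F: "finite F" "F \<subseteq> carrier L" "carrier L \<subseteq> sp (I \<union> F)"
    using enriched_lieD(6)[OF assms] fin_dim_quotient_iff unfolding finite_over_def by blast
  have "\<forall>f\<in>F. \<exists>N. \<forall>n\<ge>N. component n f = \<zero>" using component_eventually_zero F(2) by blast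
  then obtain M where M: "\<And>f n. f \<in> F \<Longrightarrow> n \<ge> M f \<Longrightarrow> component n f = \<zero>" by metis
  obtain N where N: "\<And>f. f \<in> F \<Longrightarrow> M f \<le> N"
    using F(1) by (metis finite_imageI finite_nat_set_iff_bounded_le image_eqI)
  have high: "part L n \<subseteq> I" if n: "N \<le> n" for n
  proof
    fix x assume x: "x \<in> part L n"
    let ?S = "{x \<in> carrier L. component n x \<in> I}"
    have "component n \<zero> = \<zero>"
      using component_of_part[OF subspD(3)[OF subsp_part]] by simp
    then have "subsp ?S"
      by (intro subspI) (auto simp: component_add component_smult subspD[OF subsp_ideal])
    moreover have "component n f = \<zero>" if "f \<in> F" for f
      using M[OF that] N[OF that] n by simp
    then have "I \<union> F \<subseteq> ?S"
      using gradedD(2)[OF graded_I] subspD(2)[OF subsp_ideal] F(2)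
        subspD(3)[OF subsp_ideal] by auto
    ultimately have "sp (I \<union> F) \<subseteq> ?S" by (rule sp_least[rotated])
    then have "component n x \<in> I" using F(3) part_carrier[OF x] by blast
    then show "x \<in> I" using component_of_part[OF x, of n] by simp
  qed
  have "canonical (max j N) \<subseteq> I"
    using j left_power_antimono[of j "max j N"] high
    by (intro canonical_least subsp_ideal) auto
  then show thesis by (rule that)
qed

text \<open>
  A sequence that is eventually constant modulo each ideal defines a point of the inverse limit by its
  eventual values, and bijectivity of the natural map provides the limit.
\<close>

lemma complete_enriched_limit:
  fixes c :: "nat \<Rightarrow> 'a"
  assumes complete: "complete_enriched_lie L \<J>"
    and c: "\<And>k. c k \<in> part L n"
    and cauchy: "\<And>I. I \<in> \<J> \<Longrightarrow> \<exists>K. \<forall>k\<ge>K. c k \<ominus> c K \<in> I"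
  shows "\<exists>x\<in>part L n. \<forall>I\<in>\<J>. \<exists>K. \<forall>k\<ge>K. x \<ominus> c k \<in> I"
proof -
  have enr: "enriched_lie L \<J>" using complete unfolding complete_enriched_lie_def by blast
  have bij: "bij_betw (\<lambda>x. \<lambda>I\<in>\<J>. I +> x) (part L n) (limit_part L \<J> n)"
    using complete unfolding complete_enriched_lie_def by blast
  note sub = enriched_lieD(3)[OF enr]
  obtain K where K: "\<And>I k. I \<in> \<J> \<Longrightarrow> K I \<le> k \<Longrightarrow> c k \<ominus> c (K I) \<in> I" using cauchy by metis
  have cc: "c k \<in> carrier L" for k using c part_carrier by blast
  define \<xi> where "\<xi> = (\<lambda>I\<in>\<J>. I +> c (K I))"
  have "\<xi> \<in> limit_part L \<J> n"
    unfolding limit_part_def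
  proof (intro CollectI conjI ballI impI)
    show "\<xi> \<in> (\<Pi>\<^sub>E I\<in>\<J>. part (quotient_lie L I) n)" using c unfolding \<xi>_def by auto
    fix I J assume I: "I \<in> \<J>" and J: "J \<in> \<J>" and JI: "J \<subseteq> I"
    let ?m = "max (K I) (K J)"
    have "c ?m \<ominus> c (K J) \<in> I" "c ?m \<ominus> c (K I) \<in> I" 
      using K[OF J, of ?m] K[OF I, of ?m] JI by auto
    then have "c (K J) \<ominus> c (K I) \<in> I"
      using subsp_diff_trans[OF sub[OF I] cc cc cc] subsp_diff_sym[OF sub[OF I] cc cc] by blast
    then have "I +> c (K J) = I +> c (K I)" using coset_eq_iff[OF sub[OF I] cc cc] by blast
    then show "I <+> \<xi> J = \<xi> I"
      using sum_coset[OF sub[OF I] sub[OF J] JI cc] I J unfolding \<xi>_def by simp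
  qed
  then have "\<xi> \<in> (\<lambda>x. \<lambda>I\<in>\<J>. I +> x) ` part L n"
    unfolding bij_betw_imp_surj_on[OF bij] .
  then obtain x where x: "\<xi> = (\<lambda>I\<in>\<J>. I +> x)" "x \<in> part L n" by (rule imageE)
  have xc: "x \<in> carrier L" using x(2) part_carrier by blast
  have "x \<ominus> c k \<in> I" if I: "I \<in> \<J>" and k: "K I \<le> k" for I k
  proof -
    have "I +> x = I +> c (K I)" using fun_cong[OF x(1), of I] I unfolding \<xi>_def by simp
    then have "x \<ominus> c (K I) \<in> I" using coset_eq_iff[OF sub[OF I] xc cc] by blast
    then show ?thesis
      using subsp_diff_trans[OF sub[OF I] xc cc cc] subsp_diff_sym[OF sub[OF I] cc cc K[OF I k]] by blast
  qed
  then show ?thesis using x(2) by blast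
qed

end

section \<open>Comparison of structures\<close>

context degreewise_generated
begin

lemma finite_over_canonical_part: "finite_over (canonical k \<inter> part L n) (part L n)"
proof (cases "n \<le> k")
  case True
  show ?thesis
    by (rule finite_over_mono[OF _ _ subset_refl finite_over_left_power[of k n]])
      (use left_power_subset_canonical part_carrier in blast)+
next
  case False
  then have "canonical k \<inter> part L n = part L n" using part_subset_canonical[of k n] by auto
  then show ?thesis using finite_over_refl[OF subspD(1)[OF subsp_part]] by simp
qed

lemma finite_over_canonical: "finite_over (canonical k) (carrier L)"
proof -
  obtain F where F: "\<And>n. finite (F n)" "\<And>n. F n \<subseteq> carrier L"
      "\<And>n. part L n \<subseteq> sp ((canonical k \<inter> part L n) \<union> F n)"
    using finite_over_canonical_part[of k] unfolding finite_over_def by metis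
  let ?F = "\<Union>n\<in>{..k}. F n"
  have c: "canonical k \<union> ?F \<subseteq> carrier L" using F(2) subspD(1)[OF subsp_canonical] by blast
  have "part L n \<subseteq> sp (canonical k \<union> ?F)" for n
  proof (cases "n \<le> k")
    case True
    then have "sp ((canonical k \<inter> part L n) \<union> F n) \<subseteq> sp (canonical k \<union> ?F)"
      by (intro sp_mono c) auto
    then show ?thesis using F(3) by blast
  next
    case False
    then show ?thesis using part_subset_canonical[of k n] sp_superset[OF c] by auto
  qed
  then have "sp homogeneous \<subseteq> sp (canonical k \<union> ?F)"
    unfolding homogeneous_def by (intro sp_least sp_subspace c) blast
  moreover have "carrier L = sp homogeneous"
    using graded_eq_span[OF graded_carrier] homogeneous_carrier by (simp add: Int_absorb1)
  ultimately have "carrier L \<subseteq> sp (canonical k \<union> ?F)" by simp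
  moreover have "finite ?F" "?F \<subseteq> carrier L" using F(1,2) by blast+
  ultimately show ?thesis unfolding finite_over_def by blast
qed

text \<open>
  Modulo a canonical ideal there is a smallest member of the family.
\<close>

lemma directed_below:
  assumes "enriched_lie L \<J>"
  obtains I where "I \<in> \<J>" "\<And>J. J \<in> \<J> \<Longrightarrow> I \<subseteq> J <+> canonical k"
proof -
  note sub = enriched_lieD(3)[OF assms]
  obtain I where I: "I \<in> \<J>" "\<forall>J\<in>\<J>. (I <+> canonical k) \<inter> carrier L \<subseteq> J <+> canonical k"
    using directed_minimum[OF finite_over_canonical subsp_canonical enriched_lieD(1)[OF assms] sub
        enriched_lieD(4)[OF assms]] by blast
  have "I \<subseteq> (I <+> canonical k) \<inter> carrier L"
    using sum_upper(1)[OF sub[OF I(1)] subsp_canonical] subspD(1)[OF sub[OF I(1)]] by blast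
  then show thesis using that[OF I(1)] I(2) by blast
qed

text \<open>
  The closure of the ideal \<open>canonical k\<close> for the topology defined by \<open>\<J>\<close>. These closures replace the
  family \<open>\<J>\<close>, whose index set is arbitrary, by a decreasing sequence: each closure contains a member of
  \<open>\<J>\<close>, and each member of \<open>\<J>\<close> contains a closure.
\<close>

definition closure_ideal :: "'a set set \<Rightarrow> nat \<Rightarrow> 'a set" where
  "closure_ideal \<J> k = (\<Inter>I\<in>\<J>. I <+> canonical k)"

lemma closure_ideal:
  assumes "enriched_lie L \<J>"
  shows "subsp (closure_ideal \<J> k)" "canonical k \<subseteq> closure_ideal \<J> k"
    "closure_ideal \<J> (Suc k) \<subseteq> closure_ideal \<J> k"
    "\<exists>I\<in>\<J>. I \<subseteq> closure_ideal \<J> k" "I \<in> \<J> \<Longrightarrow> \<exists>k. closure_ideal \<J> k \<subseteq> I"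
proof -
  note sub = enriched_lieD(3)[OF assms]
  show "subsp (closure_ideal \<J> k)"
    unfolding closure_ideal_def using enriched_lieD(1)[OF assms] sub
    by (intro subsp_Inter) (auto intro: subsp_sum subsp_canonical)
  show "canonical k \<subseteq> closure_ideal \<J> k"
    unfolding closure_ideal_def by (intro INF_greatest sum_upper(2) sub subsp_canonical)
  show "closure_ideal \<J> (Suc k) \<subseteq> closure_ideal \<J> k"
    unfolding closure_ideal_def by (intro INF_mono' sum_mono canonical_antimono) auto
  show "\<exists>I\<in>\<J>. I \<subseteq> closure_ideal \<J> k"
    using directed_below[OF assms, of k] unfolding closure_ideal_def by (metis INF_greatest)
  assume I: "I \<in> \<J>"
  then obtain k where k: "canonical k \<subseteq> I" using enriched_contains_canonical[OF assms] by blast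
  have "I <+> canonical k \<subseteq> I" by (intro sum_least sub I subsp_canonical subset_refl k)
  then show "\<exists>k. closure_ideal \<J> k \<subseteq> I" unfolding closure_ideal_def using I by blast
qed

lemma complete_generated_closure:
  assumes complete: "complete_enriched_lie L \<J>"
  shows "complete_generated L V (closure_ideal \<J>)"
proof -
  have enr: "enriched_lie L \<J>" using complete unfolding complete_enriched_lie_def by blast
  note sub = enriched_lieD(3)[OF enr] and cl = closure_ideal[OF enr]
  show ?thesis
  proof (intro complete_generated.intro complete_filtration.intro complete_filtration_axioms.intro
      complete_generated_axioms.intro degreewise_generated_axioms lie_algebra_axioms)
    show "subsp (closure_ideal \<J> k)" for k by (rule cl(1))
    show "closure_ideal \<J> (Suc k) \<subseteq> closure_ideal \<J> k" for k by (rule cl(3))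
    show "bracket L x y \<in> closure_ideal \<J> k"
      if x: "x \<in> carrier L" and y: "y \<in> closure_ideal \<J> k" for x y k
      unfolding closure_ideal_def
    proof (rule INT_I)
      fix I assume I: "I \<in> \<J>"
      interpret lie_ideal L I by (rule enriched_lieD(2)[OF enr I])
      show "bracket L x y \<in> I <+> canonical k"
        using y I ideal_bracket(1)[OF x] canonical_bracket(1)[OF x] unfolding closure_ideal_def
        by (intro sum_bracket subsp_ideal subsp_canonical x) auto
    qed
    have "(\<Inter>k. closure_ideal \<J> k) \<subseteq> \<Inter>\<J>" using cl(5) by blast
    then show "(\<Inter>k. closure_ideal \<J> k) = {\<zero>}"
      unfolding enriched_lieD(5)[OF enr] using subspD(3)[OF cl(1)] by (intro subset_antisym) auto
    show "finite_over (closure_ideal \<J> k \<inter> part L n) (part L n)" for k n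
      by (rule finite_over_mono[OF _ _ subset_refl finite_over_canonical_part[of k n]])
        (use cl(2) part_carrier in blast)+
    show "\<exists>r. left_power r \<inter> part L n \<subseteq> closure_ideal \<J> m" for n m
      using left_power_subset_canonical[of m] cl(2)[of m] by blast
    show "complete_wrt (part L n) (\<lambda>k. closure_ideal \<J> k \<inter> part L n)" for n
      unfolding complete_wrt_def
    proof (intro allI impI)
      fix c assume "\<forall>k. c k \<in> part L n" "\<forall>k. c (Suc k) \<ominus> c k \<in> closure_ideal \<J> k \<inter> part L n"
      then have c: "c k \<in> part L n" "c k \<in> carrier L" "c (Suc k) \<ominus> c k \<in> closure_ideal \<J> k" for k
        using part_carrier by blast+
      have tel: "c k \<ominus> c m \<in> closure_ideal \<J> m" if "m \<le> k" for m k
        by (rule telescope[of "closure_ideal \<J>" c, OF cl(1,3) c(2,3) that])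
      have "\<exists>K. \<forall>k\<ge>K. c k \<ominus> c K \<in> I" if "I \<in> \<J>" for I using cl(5)[OF that] tel by blast
      then obtain x where x: "x \<in> part L n" "\<forall>I\<in>\<J>. \<exists>K. \<forall>k\<ge>K. x \<ominus> c k \<in> I"
        using complete_enriched_limit[of \<J> c n, OF complete c(1)] by blast
      have xc: "x \<in> carrier L" using x(1) part_carrier by blast
      have "x \<ominus> c k \<in> I <+> canonical k" if I: "I \<in> \<J>" for I k
      proof -
        note s = subsp_sum[OF sub[OF I] subsp_canonical, of k]
        obtain K where K: "\<forall>k\<ge>K. x \<ominus> c k \<in> I" using x(2) I by blast
        let ?m = "max K k"
        have "x \<ominus> c ?m \<in> I <+> canonical k"
          using K sum_upper(1)[OF sub[OF I] subsp_canonical, of k] by auto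
        moreover have "c ?m \<ominus> c k \<in> I <+> canonical k"
          using tel[of k ?m] I unfolding closure_ideal_def by auto
        ultimately show ?thesis by (rule subsp_diff_trans[OF s xc c(2) c(2)])
      qed
      moreover have "x \<ominus> c k \<in> part L n" for k by (rule subsp_diff[OF subsp_part x(1) c(1)])
      ultimately show "\<exists>x\<in>part L n. \<forall>k. x \<ominus> c k \<in> closure_ideal \<J> k \<inter> part L n"
        using x(1) unfolding closure_ideal_def by blast
    qed
  qed
qed

text \<open>
  The canonical ideals are closed. This is checked on homogeneous components: in degrees above \<open>k\<close> there is
  nothing to show, and in the other degrees \<open>canonical k\<close> is a power of \<open>L\<close>, which is closed.
\<close>

lemma closure_ideal_eq:
  assumes complete: "complete_enriched_lie L \<J>"
  shows "closure_ideal \<J> k = canonical k"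
proof
  have enr: "enriched_lie L \<J>" using complete unfolding complete_enriched_lie_def by blast
  note cl = closure_ideal[OF enr]
  interpret complete_generated L V "closure_ideal \<J>" by (rule complete_generated_closure[OF complete])
  show "canonical k \<subseteq> closure_ideal \<J> k" by (rule cl(2))
  show "closure_ideal \<J> k \<subseteq> canonical k"
  proof
    fix x assume x: "x \<in> closure_ideal \<J> k"
    have xc: "x \<in> carrier L" using x subspD(2)[OF cl(1)] by blast
    have "component n x \<in> canonical k" for n
    proof (cases "n \<le> k")
      case False
      then show ?thesis using component_part[OF xc, of n] part_subset_canonical[of k n] by auto
    next
      case True
      let ?y = "component n x"
      have y: "?y \<in> part L n" "?y \<in> carrier L" using component_part[OF xc] component_closed[OF xc] .
      have "?y \<in> (left_power k \<inter> part L n) <+> closure_ideal \<J> m" for m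
      proof -
        obtain I where I: "I \<in> \<J>" "I \<subseteq> closure_ideal \<J> m" using cl(4) by blast
        interpret I: lie_ideal L I by (rule enriched_lieD(2)[OF enr I(1)])
        have "x \<in> I <+> canonical k" using x I(1) unfolding closure_ideal_def by blast
        then obtain s where s: "s \<in> I" "x \<ominus> s \<in> canonical k"
          using mem_sum[OF I.subsp_ideal subsp_canonical] by blast
        have sc: "s \<in> carrier L" using s(1) subspD(2)[OF I.subsp_ideal] by blast
        let ?t = "component n s"
        have t: "?t \<in> I" "?t \<in> part L n" "?t \<in> carrier L"
          using gradedD(2)[OF I.graded_I s(1)] component_part[OF sc] component_closed[OF sc] .
        have "?y \<ominus> ?t \<in> canonical k"
          using gradedD(2)[OF graded_canonical s(2), of n] component_diff[OF xc sc] by simp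
        moreover have "?y \<ominus> ?t \<in> part L n" by (rule subsp_diff[OF subsp_part y(1) t(2)])
        ultimately have "?y \<ominus> ?t \<in> left_power k \<inter> part L n"
          using canonical_low_degree True by blast
        moreover have "?y \<ominus> (?y \<ominus> ?t) \<in> closure_ideal \<J> m"
          using t(1,3) I(2) y(2) by (simp add: diff_arith subset_eq)
        ultimately show ?thesis by (intro sumI[OF subsp_left_power_part cl(1) y(2)])
      qed
      then have "?y \<in> left_power k" using closed_inD(3)[OF closed_in_left_power y(1)] by blast
      then show ?thesis using left_power_subset_canonical by blast
    qed
    then show "x \<in> canonical k" by (rule mem_by_components[OF subsp_canonical xc])
  qed
qed

text \<open>
  The canonical filtration is complete because it consists of its own closures for \<open>\<J>\<^sub>0\<close>. Let \<open>I\<close> be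
  the member of \<open>\<J>\<close> that is smallest modulo \<open>canonical k\<close>, and let \<open>y\<close> be a homogeneous element of
  \<open>I\<close>. For each \<open>m\<close> it can be changed by an element of \<open>canonical k\<close> to some \<open>c m\<close> in the closure
  \<open>closure_ideal \<J> m\<close>. A limit of these \<open>c m\<close> lies in all members of \<open>\<J>\<close> and is zero, while it is still
  congruent to \<open>y\<close>.
\<close>

lemma enriched_below_canonical:
  assumes complete: "complete_enriched_lie L \<J>\<^sub>0" and enr: "enriched_lie L \<J>"
  shows "\<exists>I\<in>\<J>. I \<subseteq> canonical k"
proof -
  have "closure_ideal \<J>\<^sub>0 = canonical" using closure_ideal_eq[OF complete] by blast
  then interpret complete_generated L V canonical
    using complete_generated_closure[OF complete] by simp
  note sub = enriched_lieD(3)[OF enr] and cl = closure_ideal[OF enr]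
  obtain I where I: "I \<in> \<J>" "\<And>J. J \<in> \<J> \<Longrightarrow> I \<subseteq> J <+> canonical k"
    using directed_below[OF enr] by blast
  interpret I: lie_ideal L I by (rule enriched_lieD(2)[OF enr I(1)])
  have "y \<in> canonical k" if y: "y \<in> I" "y \<in> part L n" for y n
  proof -
    have yc: "y \<in> carrier L" using y(2) part_carrier by blast
    have "\<exists>c. c \<in> part L n \<and> c \<in> closure_ideal \<J> m \<and> y \<ominus> c \<in> canonical k" for m
    proof -
      obtain J where J: "J \<in> \<J>" "J \<subseteq> closure_ideal \<J> m" using cl(4) by blast
      interpret J: lie_ideal L J by (rule enriched_lieD(2)[OF enr J(1)])
      obtain s where s: "s \<in> J" "y \<ominus> s \<in> canonical k"
        using I(2)[OF J(1)] y(1) mem_sum[OF J.subsp_ideal subsp_canonical] by blast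
      have sc: "s \<in> carrier L" using s(1) subspD(2)[OF J.subsp_ideal] by blast
      have "y \<ominus> component n s \<in> canonical k"
        using gradedD(2)[OF graded_canonical s(2), of n] component_diff[OF yc sc]
          component_of_part[OF y(2), of n] by simp
      then show ?thesis
        using J(2) gradedD(2)[OF J.graded_I s(1), of n] component_part[OF sc, of n] by blast
    qed
    then obtain c where c: "\<And>m. c m \<in> part L n" "\<And>m. c m \<in> closure_ideal \<J> m"
        "\<And>m. y \<ominus> c m \<in> canonical k" by metis
    have cc: "c m \<in> carrier L" for m using c(1) part_carrier by blast
    (* The minimum with k keeps D m above the m-th canonical ideal also for m < k. *)
    define D where "D m = closure_ideal \<J> m \<inter> canonical (min m k) \<inter> part L n" for m
    obtain x where x: "x \<in> part L n" "\<And>m. x \<ominus> c m \<in> D m"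
    proof (rule complete_coarser_part[of D n c])
      show "subsp (D m)" for m unfolding D_def by (intro subsp_Int cl(1) subsp_canonical subsp_part)
      show "canonical m \<inter> part L n \<subseteq> D m" for m
        unfolding D_def using cl(2)[of m] canonical_antimono[of "min m k" m] by auto
      show "D m \<subseteq> part L n" for m unfolding D_def by blast
      show "D (Suc m) \<subseteq> D m" for m
        unfolding D_def by (intro Int_mono cl(3) canonical_antimono subset_refl) simp
      show "c (Suc m) \<ominus> c m \<in> D m" for m
      proof -
        have "c (Suc m) \<ominus> c m \<in> closure_ideal \<J> m"
          using c(2)[of "Suc m"] cl(3)[of m] by (intro subsp_diff[OF cl(1) _ c(2)]) blast
        moreover have "c (Suc m) \<ominus> c m \<in> canonical k"
          by (rule subsp_diff_trans[OF subsp_canonical cc yc cc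
                subsp_diff_sym[OF subsp_canonical yc cc c(3)] c(3)])
        then have "c (Suc m) \<ominus> c m \<in> canonical (min m k)"
          using canonical_antimono[of "min m k" k] by auto
        moreover have "c (Suc m) \<ominus> c m \<in> part L n" by (rule subsp_diff[OF subsp_part c(1) c(1)])
        ultimately show ?thesis unfolding D_def by blast
      qed
    qed (use c(1) in auto)
    have xc: "x \<in> carrier L" using x(1) part_carrier by blast
    have "x \<in> closure_ideal \<J> m" for m
      using subsp_diff_mem[OF cl(1) xc _ c(2)] x(2)[of m] unfolding D_def by blast
    then have "x \<in> \<Inter>\<J>" using cl(5) by blast
    then have "x = \<zero>" using enriched_lieD(5)[OF enr] by blast
    moreover have "x \<ominus> c k \<in> canonical k" using x(2)[of k] unfolding D_def by simp
    ultimately have "c k \<in> canonical k"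
      using subsp_diff_sym[OF subsp_canonical xc cc] cc by fastforce
    then show ?thesis by (rule subsp_diff_mem[OF subsp_canonical yc c(3)])
  qed
  then have "I \<subseteq> canonical k"
    using gradedD(2)[OF I.graded_I] component_part subspD(2)[OF I.subsp_ideal]
    by (metis mem_by_components[OF subsp_canonical] subsetI)
  then show ?thesis using I(1) by blast
qed

lemma enriched_canonical:
  assumes enr: "enriched_lie L \<J>"
  shows "enriched_lie L (canonical_structure L)"
  unfolding enriched_lie_def canonical_structure_eq
proof (intro conjI ballI)
  show "graded_lie_algebra L" by (rule graded_lie_algebra_axioms)
  fix I assume "I \<in> range canonical"
  then obtain k where k: "I = canonical k" by blast
  interpret lie_ideal L I
    unfolding k by unfold_locales (rule graded_ideal_canonical)
  show "graded_ideal L I" by (rule ideal)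
  show "fin_dim_lie (quotient_lie L I)"
    unfolding fin_dim_quotient_iff using finite_over_canonical k by simp
  show "nilpotent_lie (quotient_lie L I)"
    unfolding nilpotent_quotient_iff
    using left_power_subset_canonical[of k] lie_power_Suc_eq[of k] k by (intro exI[of _ "Suc k"]) simp
  fix J assume "J \<in> range canonical"
  then obtain j where j: "J = canonical j" by blast
  have "canonical (max j k) \<subseteq> I \<inter> J"
    using canonical_antimono[of k "max j k"] canonical_antimono[of j "max j k"] k j by auto
  then show "\<exists>K\<in>range canonical. K \<subseteq> I \<inter> J" by blast
next
  have "\<Inter>(range canonical) \<subseteq> I" if I: "I \<in> \<J>" for I
  proof -
    obtain k where "canonical k \<subseteq> I" using enriched_contains_canonical[OF enr I] .
    then show ?thesis by blast
  qed
  then have "\<Inter>(range canonical) \<subseteq> \<Inter>\<J>" by (rule Inter_greatest)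
  then show "\<Inter>(range canonical) = {\<zero>}"
    unfolding enriched_lieD(5)[OF enr] using subspD(3)[OF subsp_canonical] by (intro subset_antisym) auto
qed simp

end

context lie_algebra
begin

lemma id_hom: "id \<in> graded_lie_hom L L"
  unfolding graded_lie_hom_def module_hom_def by auto

lemma enriched_morphism_idI:
  assumes "enriched_lie L \<I>" "enriched_lie L \<J>" "\<And>J. J \<in> \<J> \<Longrightarrow> \<exists>I\<in>\<I>. I \<subseteq> J"
  shows "enriched_morphism L \<I> L \<J> id"
proof -
  have "J = {x \<in> carrier L. id x \<in> J}" if "J \<in> \<J>" for J
    using subspD(2)[OF enriched_lieD(3)[OF assms(2) that]] by auto
  then show ?thesis unfolding enriched_morphism_def using assms id_hom by metis
qed

lemma degreewise_generatedI:
  assumes "finite_type (quotient_lie L (lie_power L 2))"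
  obtains V where "degreewise_generated L V"
proof -
  have eq: "lie_power L 2 = left_power 1" using lie_power_Suc_eq[of 1] by (simp add: numeral_2_eq_2)
  have "graded_ideal L (left_power 1)"
    unfolding graded_ideal_def
    using subsp_left_power[of 1] graded_left_power[of 1] graded_iff[OF subsp_left_power[of 1]]
      left_power_bracket_left[of _ _ 1] left_power_bracket[of _ 1 _ 0] left_power_Suc_subset[of 1]
    by auto
  then interpret lie_ideal L "left_power 1" by unfold_locales
  obtain V where "\<And>n. finite (V n)" "\<And>n. V n \<subseteq> part L n" "\<And>n. part L n \<subseteq> sp (V n \<union> left_power 1)"
    using finite_type_quotientD assms unfolding eq by metis
  then have "degreewise_generated L V" by unfold_locales
  then show thesis by (rule that)
qed

end

theorem proposition4:
  fixes L :: "'a graded_lie" and \<I>\<^sub>0 :: "'a set set"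
  assumes "complete_enriched_lie L \<I>\<^sub>0"
    and "finite_type (quotient_lie L (lie_power L 2))"
  shows "enriched_lie L (canonical_structure L) \<and>
    (\<forall>\<J>. enriched_lie L \<J> \<longrightarrow> equivalent_structures L \<J> (canonical_structure L))"
proof -
  have enr: "enriched_lie L \<I>\<^sub>0" using assms(1) unfolding complete_enriched_lie_def by blast
  then have "graded_lie_algebra L" unfolding enriched_lie_def by blast
  then interpret lie_algebra L unfolding lie_algebra_def .
  obtain V where "degreewise_generated L V" using degreewise_generatedI[OF assms(2)] .
  then interpret degreewise_generated L V .
  note can = enriched_canonical[OF enr]
  have "equivalent_structures L \<J> (canonical_structure L)" if \<J>: "enriched_lie L \<J>" for \<J>
    unfolding equivalent_structures_def
  proof
    show "enriched_morphism L \<J> L (canonical_structure L) id"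
    proof (rule enriched_morphism_idI[OF \<J> can])
      fix I assume "I \<in> canonical_structure L"
      then show "\<exists>J\<in>\<J>. J \<subseteq> I"
        using enriched_below_canonical[OF assms(1) \<J>] unfolding canonical_structure_eq by blast
    qed
    show "enriched_morphism L (canonical_structure L) L \<J> id"
    proof (rule enriched_morphism_idI[OF can \<J>])
      fix J assume "J \<in> \<J>"
      then obtain k where "canonical k \<subseteq> J" by (rule enriched_contains_canonical[OF \<J>])
      then show "\<exists>I\<in>canonical_structure L. I \<subseteq> J"
        unfolding canonical_structure_eq by blast
    qed
  qed
  then show ?thesis using can by blast
qed

end
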